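(* Let $m \geq 2$ be a fixed integer, and assume $\mu_1, \ldots, \mu_m \in \mathcal{P}(\mathbb{C})$. Let $\{X_{i,k} : 1 \leq k \leq m, i \geq 1\}$ be a collection of independent random variables so that $X_{i,k}$ has distribution $\mu_k$ for each $i \geq 1$. For each $n \geq 1$, define the degree $n$ polynomials \[ p_{n,k}(z) := \prod_{i=1}^n (z - X_{i,k}), \qquad 1 \leq k \leq m. \] Let $\varphi: \mathbb{C} \to \mathbb{C}$ be a smooth and compactly supported function, and assume that there is a constant $C>0$, independent of $n$, such that for all $n>C$, \[ \mathbb{P}\left( \bigcup_{k \neq l} \left\{ \frac{1}{2} \leq \left| \frac{p_{n,k}(Z)}{p_{n,l}(Z)} \right| \leq 2 \right\} \right) \le \frac{C}{\log^3 n}, \] where $Z$ is a random variable, uniformly distributed on the support of $\varphi$, independent of $X_{i,k}$, $1 \leq k \leq m$, $i \geq 1$. Then \[ \frac{1}{n} \sum_{i=1}^n \varphi(z_i^{(n)}) \longrightarrow \frac{1}{2\pi} \int_{\mathbb{C}} \Delta\varphi(z) \left( \max_{1 \leq k \leq m} U_{\mu_k}(z) \right) d\lambda(z) \] in probability as $n \to \infty$, where $z_1^{(n)}, \ldots, z_n^{(n)}$ are the zeros (counted with multiplicity) of the sum $\sum_{k=1}^m p_{n,k}$.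
   Context: $\mathcal{P}(\mathbb{C})$ is the set of probability measures on $\mathbb{C}$ with compact support. $\lambda$ is Lebesgue measure on $\mathbb{C}$. The logarithmic potential of $\mu\in\mathcal{P}(\mathbb{C})$ is $U_\mu:\mathbb{C}\to[-\infty,+\infty)$, $U_\mu(z) := \int_{\mathbb{C}} \log|z-w|\,d\mu(w)$. "Uniformly distributed on the support of $\varphi$" means distributed according to normalized Lebesgue measure on $\operatorname{supp}\varphi$ (this presupposes that $\varphi$ is not identically zero). The ratio $p_{n,k}(Z)/p_{n,l}(Z)$ is well defined outside an event of probability zero. *)

theory Defs
  imports "HOL-Probability.Probability"
    "HOL-Computational_Algebra.Fundamental_Theorem_Algebra"
begin

definition msupport :: "'a::topological_space measure \<Rightarrow> 'a set" where
  "msupport \<mu> = {x. \<forall>V. open V \<longrightarrow> x \<in> V \<longrightarrow> 0 < emeasure \<mu> V}"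

definition compact_prob_measures :: "complex measure set" where
  "compact_prob_measures =
     {\<mu>. prob_space \<mu> \<and> sets \<mu> = sets borel \<and> compact (msupport \<mu>)}"

definition fsupport :: "('a::topological_space \<Rightarrow> 'b::zero) \<Rightarrow> 'a set" where
  "fsupport f = closure {x. f x \<noteq> 0}"

(* Derivatives are real Frechet derivatives, so on the complex plane this is
   differentiability in the sense of two real variables, not holomorphy. *)
primrec times_cont_diff ::
  "nat \<Rightarrow> ('a::real_normed_vector \<Rightarrow> 'b::real_normed_vector) \<Rightarrow> bool" where
  "times_cont_diff 0 f \<longleftrightarrow> continuous_on UNIV f"
| "times_cont_diff (Suc k) f \<longleftrightarrow>
     (\<forall>x. f differentiable (at x)) \<and>
     (\<forall>v. times_cont_diff k (\<lambda>x. frechet_derivative f (at x) v))"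

definition smooth :: "('a::real_normed_vector \<Rightarrow> 'b::real_normed_vector) \<Rightarrow> bool" where
  "smooth f \<longleftrightarrow> (\<forall>k. times_cont_diff k f)"

definition dir_deriv ::
  "'a::real_normed_vector \<Rightarrow> ('a \<Rightarrow> 'b::real_normed_vector) \<Rightarrow> 'a \<Rightarrow> 'b" where
  "dir_deriv v f x = frechet_derivative f (at x) v"

definition laplacian :: "(complex \<Rightarrow> complex) \<Rightarrow> complex \<Rightarrow> complex" where
  "laplacian f z = dir_deriv 1 (dir_deriv 1 f) z + dir_deriv \<i> (dir_deriv \<i> f) z"

(* The library has ln 0 = 0 for reals; the logarithmic potential needs minus infinity there. *)
definition ext_ln :: "real \<Rightarrow> ereal" where
  "ext_ln r = (if r = 0 then -\<infinity> else ereal (ln r))"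

(* The extended-real integral of log |z - w|, as the integral of the positive part minus that of
   the negative part (e2ennreal sends negative arguments to 0).  The positive part has a finite
   integral when the measure has compact support, so the value lies in [-\<infinity>, \<infinity>). *)
definition log_potential :: "complex measure \<Rightarrow> complex \<Rightarrow> ereal" where
  "log_potential \<mu> z =
     enn2ereal (\<integral>\<^sup>+ w. e2ennreal (ext_ln (cmod (z - w))) \<partial>\<mu>) -
     enn2ereal (\<integral>\<^sup>+ w. e2ennreal (- ext_ln (cmod (z - w))) \<partial>\<mu>)"

definition rand_poly ::
  "(nat \<Rightarrow> nat \<Rightarrow> 'a \<Rightarrow> complex) \<Rightarrow> nat \<Rightarrow> nat \<Rightarrow> 'a \<Rightarrow> complex poly" where
  "rand_poly X n k \<omega> = (\<Prod>i=1..n. [:- X i k \<omega>, 1:])"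

definition converges_in_prob ::
  "'a measure \<Rightarrow> (nat \<Rightarrow> 'a \<Rightarrow> 'b::metric_space) \<Rightarrow> 'b \<Rightarrow> bool" where
  "converges_in_prob M Y c \<longleftrightarrow>
     (\<forall>n. Y n \<in> borel_measurable M) \<and>
     (\<forall>\<epsilon>>0. (\<lambda>n. measure M {\<omega> \<in> space M. dist (Y n \<omega>) c > \<epsilon>}) \<longlonglongrightarrow> 0)"

end

theory Submission
  imports Defs "HOL-Real_Asymp.Real_Asymp"
begin

text \<open>Since \<open>log \<bar>z - w\<bar>\<close> is, up to the factor \<open>2\<pi>\<close>, the fundamental solution of the Laplacian, the mean of
  \<open>\<phi>\<close> over the zeros of \<open>P\<^sub>n = p\<^sub>n\<^sub>,\<^sub>1 + \<dots> + p\<^sub>n\<^sub>,\<^sub>m\<close> equals \<open>1/(2\<pi>)\<close> times the integral of \<open>\<Delta>\<phi>\<close> against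
  \<open>(log \<bar>P\<^sub>n\<bar> - log m) / n\<close>. It therefore suffices that this function converges to \<open>max\<^sub>k U\<^sub>k\<close>
  in mean, jointly in the randomness and in \<open>z\<close> uniform on the support of \<open>\<phi>\<close>.
  Where the \<open>\<bar>p\<^sub>n\<^sub>,\<^sub>k\<bar>\<close> are pairwise separated by a factor 2, the largest one dominates the sum, so
  \<open>log \<bar>P\<^sub>n\<bar>\<close> is within a constant of \<open>max\<^sub>k log \<bar>p\<^sub>n\<^sub>,\<^sub>k\<bar>\<close>. On the exceptional set, of measure
  \<open>O(1 / log\<^sup>3 n)\<close>, Cauchy-Schwarz (used as a weighted AM-GM inequality) suffices: the zeros of \<open>P\<^sub>n\<close> have modulus \<open>O(n)\<close>, so the second
  moment of \<open>log \<bar>P\<^sub>n\<bar> / n\<close> is only \<open>O(log\<^sup>2 n)\<close>. Finally \<open>log \<bar>p\<^sub>n\<^sub>,\<^sub>k\<bar> / n\<close> converges to \<open>U\<^sub>k\<close> in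
  mean square by orthogonality of the centred summands.\<close>

section \<open>The logarithm as fundamental solution of the Laplacian\<close>

text \<open>The obstacle is cancellation: where two of the moduli are comparable, \<open>P_n\<close>
  has no pointwise lower bound, and nothing is known about where its zeros cluster. The remedy is an
  average over z alone: the square of \<open>ln |z - r|\<close> is integrable near its singularity,
  with a bound that sees the point r only through its size, so the zeros may lie anywhere in a large
  disc. Independence of \<open>Z\<close> turns the probability of the exceptional event into a
  double integral, after which z is an ordinary integration variable. The exponent 3 has to beat the
  exponent 2 of the second moment: with a weight \<delta>, the exceptional set costs
  \<open>1 / (\<delta> * ln^3 n)\<close> and the second moment costs
  \<open>\<delta> * ln^2 n\<close>, and both vanish exactly when \<delta> lies well between
  \<open>ln^(-3) n\<close> and \<open>ln^(-2) n\<close>. The fundamental solution is reached through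
  the smooth functions \<open>ln (|z - w|^2 + e^2) / 2\<close>, so that no disc around the
  singularity is excised and no boundary terms occur.\<close>

lemma has_derivative_zero_outside_compact:
  fixes G :: "'a::euclidean_space \<Rightarrow> 'b::real_normed_vector"
  assumes "(G has_derivative G') (at z)" "compact K" "\<And>z. z \<notin> K \<Longrightarrow> G z = 0" "z \<notin> K"
  shows "G' = (\<lambda>_. 0)"
proof -
  have "open (- K)" using assms(2) by (auto simp: compact_imp_closed open_Compl)
  have "((\<lambda>_. 0) has_derivative G') (at z)"
    by (rule has_derivative_transform_within_open[OF assms(1) \<open>open (- K)\<close>]) (use assms in auto)
  moreover have "((\<lambda>_. 0) has_derivative (\<lambda>_. 0 :: 'b)) (at z)" by auto
  ultimately show ?thesis by (rule has_derivative_unique)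
qed

lemma integrable_continuous_compact_support:
  fixes f :: "'a::euclidean_space \<Rightarrow> 'b::{banach, second_countable_topology}"
  assumes "continuous_on UNIV f" "compact K" "\<And>z. z \<notin> K \<Longrightarrow> f z = 0"
  shows "integrable lborel f"
proof -
  have "set_integrable lborel K f"
    unfolding set_integrable_def
    by (intro borel_integrable_compact assms continuous_on_subset[OF assms(1)]) auto
  moreover have "(\<lambda>x. indicat_real K x *\<^sub>R f x) = f"
    using assms(3) by (auto simp: indicator_def fun_eq_iff)
  ultimately show ?thesis by (simp add: set_integrable_def)
qed

lemma bounded_continuous_compact_support:
  fixes f :: "'a::euclidean_space \<Rightarrow> 'b::real_normed_vector"
  assumes "continuous_on UNIV f" "compact K" "\<And>z. z \<notin> K \<Longrightarrow> f z = 0"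
  obtains B where "B > 0" "\<And>z. norm (f z) \<le> B"
proof -
  have "bounded (f ` K)"
    by (intro compact_imp_bounded compact_continuous_image continuous_on_subset[OF assms(1)] assms) auto
  then obtain B where "B > 0" "\<forall>x\<in>f ` K. norm x \<le> B" by (auto simp: bounded_pos)
  with assms(3) have "norm (f z) \<le> B" for z by (cases "z \<in> K") auto
  with \<open>B > 0\<close> that show ?thesis by blast
qed

text \<open>By translation invariance all difference quotients have integral zero, and they converge
  dominatedly to the derivative.\<close>

lemma integral_directional_derivative_eq_0:
  fixes G :: "'a::euclidean_space \<Rightarrow> 'b::euclidean_space"
  assumes G: "\<And>z. (G has_derivative G' z) (at z)"
    and cont: "continuous_on UNIV (\<lambda>z. G' z v)"
    and K: "compact K" "\<And>z. z \<notin> K \<Longrightarrow> G z = 0"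
  shows "(LINT z|lborel. G' z v) = 0"
proof -
  have G'0: "G' z v = 0" if "z \<notin> K" for z
    using has_derivative_zero_outside_compact[OF G K that] by auto
  obtain B where B: "B > 0" "\<And>z. norm (G' z v) \<le> B"
    using bounded_continuous_compact_support[OF cont K(1) G'0] by blast
  have contG: "continuous_on UNIV G"
    using G by (meson continuous_at_imp_continuous_on has_derivative_continuous)
  have intG: "integrable lborel G" by (rule integrable_continuous_compact_support[OF contG K])
  obtain r where r: "K \<subseteq> cball 0 r"
    using compact_imp_bounded[OF K(1)] by (auto simp: bounded_iff subset_iff)
  \<comment> \<open>Step sizes at most 1: then \<open>G\<close> and all its translates vanish off
    the ball of radius \<open>r + norm v\<close>, which gives a dominating function independent of
    \<open>n\<close>.\<close>
  define t where "t n = 1 / (real n + 1)" for n :: nat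
  have t: "0 < t n" "t n \<le> 1" for n by (auto simp: t_def)
  define Q where "Q n z = (1 / t n) *\<^sub>R (G (z + t n *\<^sub>R v) - G z)" for n z
  have [measurable]: "G \<in> borel_measurable borel" "(\<lambda>z. G' z v) \<in> borel_measurable borel"
    using contG cont by (auto intro: borel_measurable_continuous_onI)
  have line: "((\<lambda>s. G (z + s *\<^sub>R v)) has_derivative (\<lambda>h. h *\<^sub>R G' (z + s *\<^sub>R v) v)) (at s)" for z s
  proof -
    have "((\<lambda>s. z + s *\<^sub>R v) has_derivative (\<lambda>h. h *\<^sub>R v)) (at s)"
      by (auto intro!: derivative_eq_intros)
    from has_derivative_compose[OF this G]
    have "((\<lambda>s. G (z + s *\<^sub>R v)) has_derivative (\<lambda>h. G' (z + s *\<^sub>R v) (h *\<^sub>R v))) (at s)" .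
    moreover have "linear (G' (z + s *\<^sub>R v))"
      using G has_derivative_linear by blast
    ultimately show ?thesis by (simp add: linear_scale)
  qed
  have "(\<lambda>n. LINT z|lborel. Q n z) \<longlonglongrightarrow> (LINT z|lborel. G' z v)"
  proof (rule integral_dominated_convergence[where w="\<lambda>z. B * indicator (cball 0 (r + norm v)) z"])
    show "integrable lborel (\<lambda>z::'a. B * indicator (cball 0 (r + norm v)) z :: real)"
      using emeasure_lborel_cball_finite[of "0::'a" "r + norm v"]
      by (intro integrable_mult_right integrable_real_indicator) auto
    show "AE z in lborel. (\<lambda>n. Q n z) \<longlonglongrightarrow> G' z v"
    proof (rule AE_I2)
      fix z
      have "((\<lambda>s. (1 / s) *\<^sub>R (G (z + s *\<^sub>R v) - G z)) \<longlongrightarrow> G' z v) (at 0)"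
      proof -
        have "((\<lambda>h. norm (G (z + h *\<^sub>R v) - G z - h *\<^sub>R G' z v) / norm h) \<longlongrightarrow> 0) (at 0)"
          using line[of z 0] by (simp add: has_derivative_at)
        then have "((\<lambda>h. norm ((1 / h) *\<^sub>R (G (z + h *\<^sub>R v) - G z) - G' z v)) \<longlongrightarrow> 0) (at 0)"
        proof (rule Lim_transform_eventually)
          have "norm (G (z + h *\<^sub>R v) - G z - h *\<^sub>R G' z v) / norm h =
              norm ((1 / h) *\<^sub>R (G (z + h *\<^sub>R v) - G z) - G' z v)" if "h \<noteq> 0" for h
          proof -
            have "(1 / h) *\<^sub>R (G (z + h *\<^sub>R v) - G z) - G' z v =
              (1 / h) *\<^sub>R (G (z + h *\<^sub>R v) - G z - h *\<^sub>R G' z v)"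
              using that by (simp add: scaleR_diff_right)
            then show ?thesis by simp
          qed
          then show "\<forall>\<^sub>F h in at 0. norm (G (z + h *\<^sub>R v) - G z - h *\<^sub>R G' z v) / norm h =
              norm ((1 / h) *\<^sub>R (G (z + h *\<^sub>R v) - G z) - G' z v)"
            by (auto simp: eventually_at_filter)
        qed
        then have "((\<lambda>h. (1 / h) *\<^sub>R (G (z + h *\<^sub>R v) - G z) - G' z v) \<longlongrightarrow> 0) (at 0)"
          by (rule tendsto_norm_zero_cancel)
        then show ?thesis by (rule LIM_zero_cancel)
      qed
      moreover have "filterlim t (at 0) sequentially"
        unfolding t_def by real_asymp
      ultimately show "(\<lambda>n. Q n z) \<longlonglongrightarrow> G' z v"
        unfolding Q_def by (rule filterlim_compose)
    qed
    show "AE z in lborel. norm (Q n z) \<le> B * indicator (cball 0 (r + norm v)) z" for n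
    proof (rule AE_I2)
      fix z
      show "norm (Q n z) \<le> B * indicator (cball 0 (r + norm v)) z"
      proof (cases "z \<in> cball 0 (r + norm v)")
        case True
        have "norm (G (z + t n *\<^sub>R v) - G (z + 0 *\<^sub>R v)) \<le> B * norm (t n - 0)"
        proof (rule differentiable_bound[where S=UNIV and f="\<lambda>s. G (z + s *\<^sub>R v)"])
          show "((\<lambda>s. G (z + s *\<^sub>R v)) has_derivative (\<lambda>h. h *\<^sub>R G' (z + s *\<^sub>R v) v)) (at s)" for s
            by (rule line)
          show "onorm (\<lambda>h. h *\<^sub>R G' (z + s *\<^sub>R v) v) \<le> B" for s
            using B(2)[of "z + s *\<^sub>R v"] by (intro onorm_le) (simp add: mult.commute[of B] mult_left_mono)
        qed auto
        with True t[of n] show ?thesis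
          by (simp add: Q_def pos_divide_le_eq del: scaleR_right_diff_distrib scaleR_diff_right)
      next
        case False
        have "norm z \<le> norm (z + t n *\<^sub>R v) + norm (t n *\<^sub>R v)"
          by (metis add_diff_cancel_right' norm_triangle_ineq4)
        moreover have "norm (t n *\<^sub>R v) \<le> norm v" using t[of n] by (simp add: mult_left_le_one_le)
        ultimately have "z \<notin> cball 0 r" "z + t n *\<^sub>R v \<notin> cball 0 r"
          using False by (auto, smt (verit) norm_ge_zero)
        with r have "z \<notin> K" "z + t n *\<^sub>R v \<notin> K" by auto
        with K(2) B(1) show ?thesis by (simp add: Q_def)
      qed
    qed
  qed (auto simp: Q_def)
  moreover have "(LINT z|lborel. Q n z) = 0" for n
  proof -
    have 1: "integrable lborel (\<lambda>z. G (z + t n *\<^sub>R v))"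
      using intG by (subst (asm) lborel_distr_plus[of "t n *\<^sub>R v", symmetric], subst (asm) integrable_distr_eq)
        (auto simp: add.commute)
    have 2: "(LINT z|lborel. G (z + t n *\<^sub>R v)) = (LINT z|lborel. G z)"
      by (subst (2) lborel_distr_plus[of "t n *\<^sub>R v", symmetric], subst integral_distr)
        (auto simp: add.commute)
    show ?thesis unfolding Q_def using 1 2 intG by simp
  qed
  ultimately show ?thesis by (simp add: LIMSEQ_const_iff)
qed

section \<open>Explicit integrals over the plane\<close>

lemma lborel_complex_eq: "lborel = distr (lborel \<Otimes>\<^sub>M lborel) borel (\<lambda>(x, y). Complex x y)"
proof (rule lborel_eqI)
  have m: "(\<lambda>(x, y). Complex x y) \<in> borel_measurable (lborel \<Otimes>\<^sub>M lborel)"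
    by (simp add: Complex_eq)
  fix l u :: complex assume le: "\<And>b. b \<in> Basis \<Longrightarrow> l \<bullet> b \<le> u \<bullet> b"
  have le': "Re l \<le> Re u" "Im l \<le> Im u"
    using le[of 1] le[of \<i>] by (auto simp: Basis_complex_def)
  have "(\<lambda>(x, y). Complex x y) -` box l u \<inter> space (lborel \<Otimes>\<^sub>M lborel) = box (Re l) (Re u) \<times> box (Im l) (Im u)"
    by (auto simp: box_def Basis_complex_def space_pair_measure)
  then have "emeasure (distr (lborel \<Otimes>\<^sub>M lborel) borel (\<lambda>(x, y). Complex x y)) (box l u) =
     emeasure (lborel \<Otimes>\<^sub>M lborel) (box (Re l) (Re u) \<times> box (Im l) (Im u))"
    using m by (simp add: emeasure_distr)
  also have "\<dots> = ennreal (Re u - Re l) * ennreal (Im u - Im l)"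
    using le' by (subst lborel.emeasure_pair_measure_Times) auto
  finally show "emeasure (distr (lborel \<Otimes>\<^sub>M lborel) borel (\<lambda>(x, y). Complex x y)) (box l u) =
      ennreal (\<Prod>b\<in>Basis. (u - l) \<bullet> b)"
    using le' by (simp add: Basis_complex_def ennreal_mult)
qed simp

text \<open>Tonelli in the two real coordinates. The planar integrals below are evaluated or bounded
  one coordinate at a time, which takes the place of polar coordinates.\<close>

lemma nn_integral_lborel_complex:
  assumes [measurable]: "f \<in> borel_measurable borel"
  shows "(\<integral>\<^sup>+z. f z \<partial>lborel) = (\<integral>\<^sup>+x. \<integral>\<^sup>+y. f (Complex x y) \<partial>lborel \<partial>lborel)"
proof -
  have m[measurable]: "(\<lambda>(x, y). Complex x y) \<in> borel_measurable (lborel \<Otimes>\<^sub>M lborel)"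
    by (simp add: Complex_eq)
  show ?thesis
    by (subst lborel_complex_eq, subst nn_integral_distr, simp, simp,
        subst lborel.nn_integral_fst[symmetric]) (auto simp: case_prod_beta)
qed

lemma nn_integral_FTC_UNIV:
  fixes f F :: "real \<Rightarrow> real"
  assumes "\<And>x. DERIV F x :> f x" "continuous_on UNIV f" "\<And>x. f x \<ge> 0"
    "(F \<longlongrightarrow> A) at_bot" "(F \<longlongrightarrow> B) at_top"
  shows "(\<integral>\<^sup>+x. ennreal (f x) \<partial>lborel) = ennreal (B - A)"
proof -
  have "isCont f x" for x using assms(2) continuous_on_eq_continuous_at by blast
  note * = interval_integral_FTC_nonneg[of "-\<infinity>" \<infinity> F f A B]
  have 1: "set_integrable lborel (einterval (- \<infinity>) \<infinity>) f"
    by (rule *) (use assms \<open>\<And>x. isCont f x\<close> in \<open>auto simp: at_left_PInf at_right_MInf filterlim_filtermap o_def\<close>)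
  have 2: "(LBINT x=-\<infinity>..\<infinity>. f x) = B - A"
    by (rule *) (use assms \<open>\<And>x. isCont f x\<close> in \<open>auto simp: at_left_PInf at_right_MInf filterlim_filtermap o_def\<close>)
  from 1 have i: "integrable lborel f" by (simp add: set_integrable_def)
  from 2 have "(LINT x|lborel. f x) = B - A" by (simp add: interval_lebesgue_integral_def set_lebesgue_integral_def)
  with i assms(3) show ?thesis by (subst nn_integral_eq_integral) auto
qed

text \<open>The integrand is the Laplacian of \<open>ln (1 + |z|^2) / 2\<close>, and also half the
  area density of the unit sphere in stereographic projection. Its mass is the \<open>2 * pi\<close>
  of the fundamental solution.\<close>

lemma nn_integral_poisson_square:
  "(\<integral>\<^sup>+z. ennreal (2 / (1 + (cmod z)\<^sup>2)\<^sup>2) \<partial>lborel) = ennreal (2 * pi)"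
proof -
  have inner: "(\<integral>\<^sup>+y. ennreal (2 / (1 + x\<^sup>2 + y\<^sup>2)\<^sup>2) \<partial>lborel) = ennreal (pi / sqrt (1 + x\<^sup>2) ^ 3)" for x :: real
  proof -
    define a where "a = sqrt (1 + x\<^sup>2)"
    have a: "a > 0" "1 + x\<^sup>2 = a\<^sup>2" by (auto simp: a_def intro: add_pos_nonneg)
    have pos: "a\<^sup>2 + y\<^sup>2 > 0" for y using a by (simp add: add_pos_nonneg)
    have "(\<integral>\<^sup>+y. ennreal (2 / (a\<^sup>2 + y\<^sup>2)\<^sup>2) \<partial>lborel) = ennreal (pi / (2 * a ^ 3) - (- pi / (2 * a ^ 3)))"
    \<comment> \<open>The antiderivative comes from writing 2 a^2 = (a^2 + y^2) + (a^2 - y^2) in the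
      numerator: the first part gives the arctangent, the second is the derivative of y / (a^2 +
      y^2).\<close>
    proof (rule nn_integral_FTC_UNIV[where F="\<lambda>y. y / (a\<^sup>2 * (a\<^sup>2 + y\<^sup>2)) + arctan (y / a) / a ^ 3"])
      fix y :: real
      have q: "a\<^sup>2 + y\<^sup>2 \<noteq> 0" using pos[of y] by (metis less_irrefl)
      have d1: "((\<lambda>y. y / (a\<^sup>2 * (a\<^sup>2 + y\<^sup>2))) has_real_derivative
          (a\<^sup>2 * (a\<^sup>2 + y\<^sup>2) - y * (a\<^sup>2 * (2 * y))) / (a\<^sup>2 * (a\<^sup>2 + y\<^sup>2))\<^sup>2) (at y)"
        using a q by (auto intro!: derivative_eq_intros simp: power2_eq_square)
      have e1: "(a\<^sup>2 * (a\<^sup>2 + y\<^sup>2) - y * (a\<^sup>2 * (2 * y))) / (a\<^sup>2 * (a\<^sup>2 + y\<^sup>2))\<^sup>2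
          = (a\<^sup>2 - y\<^sup>2) / (a\<^sup>2 * (a\<^sup>2 + y\<^sup>2)\<^sup>2)"
      proof -
        have "(a\<^sup>2 * (a\<^sup>2 + y\<^sup>2) - y * (a\<^sup>2 * (2 * y))) / (a\<^sup>2 * (a\<^sup>2 + y\<^sup>2))\<^sup>2
          = (a\<^sup>2 * (a\<^sup>2 - y\<^sup>2)) / (a\<^sup>2 * (a\<^sup>2 * (a\<^sup>2 + y\<^sup>2)\<^sup>2))"
          by (rule arg_cong2[where f="(/)"]) (simp_all add: algebra_simps power2_eq_square)
        also have "\<dots> = (a\<^sup>2 - y\<^sup>2) / (a\<^sup>2 * (a\<^sup>2 + y\<^sup>2)\<^sup>2)"
          by (rule mult_divide_mult_cancel_left) (use a(1) in simp)
        finally show ?thesis .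
      qed
      have d2: "((\<lambda>y. arctan (y / a) / a ^ 3) has_real_derivative
          inverse (1 + (y / a)\<^sup>2) * (1 / a) / a ^ 3) (at y)"
        using a(1) by (intro DERIV_cdivide) (auto intro!: derivative_eq_intros)
      have e2: "inverse (1 + (y / a)\<^sup>2) * (1 / a) / a ^ 3 = 1 / (a\<^sup>2 * (a\<^sup>2 + y\<^sup>2))"
      proof -
        have "1 + (y / a)\<^sup>2 = (a\<^sup>2 + y\<^sup>2) / a\<^sup>2" using a by (simp add: field_simps)
        then show ?thesis using a(1) by (simp add: power2_eq_square power3_eq_cube)
      qed
      have e3: "(a\<^sup>2 - y\<^sup>2) / (a\<^sup>2 * (a\<^sup>2 + y\<^sup>2)\<^sup>2) + 1 / (a\<^sup>2 * (a\<^sup>2 + y\<^sup>2)) = 2 / (a\<^sup>2 + y\<^sup>2)\<^sup>2"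
      proof -
        have e: "1 / (a\<^sup>2 * (a\<^sup>2 + y\<^sup>2)) = (a\<^sup>2 + y\<^sup>2) / (a\<^sup>2 * (a\<^sup>2 + y\<^sup>2)\<^sup>2)"
          using q by (simp add: power2_eq_square)
        show ?thesis unfolding e using a(1) by (simp add: add_divide_distrib[symmetric])
      qed
      show "((\<lambda>y. y / (a\<^sup>2 * (a\<^sup>2 + y\<^sup>2)) + arctan (y / a) / a ^ 3) has_real_derivative
          2 / (a\<^sup>2 + y\<^sup>2)\<^sup>2) (at y)"
        using DERIV_add[OF d1 d2] unfolding e1 e2 e3 .
    next
      show "continuous_on UNIV (\<lambda>y. 2 / (a\<^sup>2 + y\<^sup>2)\<^sup>2)"
        using pos by (intro continuous_intros) (auto simp: less_imp_neq[symmetric] order_less_imp_not_eq2)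
      have ev: "((\<lambda>y. y / (a\<^sup>2 * (a\<^sup>2 + y\<^sup>2))) \<longlongrightarrow> 0) at_bot" "((\<lambda>y. y / (a\<^sup>2 * (a\<^sup>2 + y\<^sup>2))) \<longlongrightarrow> 0) at_top"
        "filterlim (\<lambda>y. y / a) at_bot at_bot" "filterlim (\<lambda>y. y / a) at_top at_top"
        using a(1) by real_asymp+
      have "((\<lambda>y. y / (a\<^sup>2 * (a\<^sup>2 + y\<^sup>2)) + arctan (y / a) / a ^ 3) \<longlongrightarrow> 0 + (- (pi / 2)) / a ^ 3) at_bot"
        using a by (intro tendsto_add tendsto_divide ev tendsto_const filterlim_compose[OF tendsto_arctan_at_bot]) auto
      then show "((\<lambda>y. y / (a\<^sup>2 * (a\<^sup>2 + y\<^sup>2)) + arctan (y / a) / a ^ 3) \<longlongrightarrow> - pi / (2 * a ^ 3)) at_bot"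
        by simp
      have "((\<lambda>y. y / (a\<^sup>2 * (a\<^sup>2 + y\<^sup>2)) + arctan (y / a) / a ^ 3) \<longlongrightarrow> 0 + (pi / 2) / a ^ 3) at_top"
        using a by (intro tendsto_add tendsto_divide ev tendsto_const filterlim_compose[OF tendsto_arctan_at_top]) auto
      then show "((\<lambda>y. y / (a\<^sup>2 * (a\<^sup>2 + y\<^sup>2)) + arctan (y / a) / a ^ 3) \<longlongrightarrow> pi / (2 * a ^ 3)) at_top"
        by simp
    qed auto
    then show ?thesis using a by (simp add: a_def[symmetric])
  qed
  have "(\<integral>\<^sup>+x. ennreal (pi / sqrt (1 + x\<^sup>2) ^ 3) \<partial>lborel) = ennreal (pi - (- pi))"
  proof (rule nn_integral_FTC_UNIV[where F="\<lambda>x. pi * (x / sqrt (1 + x\<^sup>2))"])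
    fix x :: real
    have p: "1 + x\<^sup>2 > 0" by (simp add: add_pos_nonneg)
    show "((\<lambda>x. pi * (x / sqrt (1 + x\<^sup>2))) has_real_derivative pi / sqrt (1 + x\<^sup>2) ^ 3) (at x)"
    proof -
      define r where "r = sqrt (1 + x\<^sup>2)"
      have r: "r > 0" "x\<^sup>2 = r\<^sup>2 - 1" using p by (auto simp: r_def)
      have sd: "((\<lambda>x. sqrt (1 + x\<^sup>2)) has_real_derivative x / r) (at x)"
        using p by (auto intro!: derivative_eq_intros simp: r_def field_simps)
      have "sqrt (1 + x\<^sup>2) \<noteq> 0" using r(1) by (simp add: r_def)
      from DERIV_cmult[OF DERIV_divide[OF DERIV_ident sd this], of pi]
      have "((\<lambda>x. pi * (x / sqrt (1 + x\<^sup>2))) has_real_derivative pi * ((r - x * (x / r)) / r\<^sup>2)) (at x)"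
        by (simp only: r_def[symmetric] power2_eq_square[of r] mult_1)
      moreover have "pi * ((r - x * (x / r)) / r\<^sup>2) = pi / r ^ 3"
      proof -
        have "r - x * (x / r) = 1 / r"
          using r by (simp add: field_simps power2_eq_square)
        then show ?thesis by (simp add: power3_eq_cube power2_eq_square)
      qed
      ultimately show ?thesis by (simp add: r_def)
    qed
  next
    have "1 + x\<^sup>2 > 0" for x :: real by (simp add: add_pos_nonneg)
    then show "continuous_on UNIV (\<lambda>x::real. pi / sqrt (1 + x\<^sup>2) ^ 3)"
      by (intro continuous_intros) (auto simp: less_imp_neq[symmetric] order_less_imp_not_eq2)
    show "((\<lambda>x. pi * (x / sqrt (1 + x\<^sup>2))) \<longlongrightarrow> - pi) at_bot" by real_asymp
    show "((\<lambda>x. pi * (x / sqrt (1 + x\<^sup>2))) \<longlongrightarrow> pi) at_top" by real_asymp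
  qed auto
  then show ?thesis
    by (subst nn_integral_lborel_complex) (simp_all add: cmod_power2 inner add.assoc[symmetric])
qed

lemma nn_integral_ln_square_real:
  "(\<integral>\<^sup>+x. ennreal ((ln \<bar>x\<bar>)\<^sup>2) * indicator {-1<..<1} x \<partial>lborel) < \<infinity>"
proof -
  have 1: "set_integrable lborel (einterval 0 1) (\<lambda>x. (ln \<bar>x\<bar>)\<^sup>2)"
  \<comment> \<open>The antiderivative arises by integrating by parts twice; its limit 0 at the
    singular endpoint is what makes the integral finite.\<close>
  proof (rule interval_integral_FTC_nonneg(1)[where F="\<lambda>x. x * (ln x)\<^sup>2 - 2 * x * ln x + 2 * x" and A=0 and B=2])
    show "(((\<lambda>x. x * (ln x)\<^sup>2 - 2 * x * ln x + 2 * x) \<circ> real_of_ereal) \<longlongrightarrow> 0) (at_right 0)"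
      unfolding zero_ereal_def at_right_ereal filterlim_filtermap o_def real_of_ereal.simps by real_asymp
    show "(((\<lambda>x. x * (ln x)\<^sup>2 - 2 * x * ln x + 2 * x) \<circ> real_of_ereal) \<longlongrightarrow> 2) (at_left 1)"
      unfolding one_ereal_def at_left_ereal filterlim_filtermap o_def real_of_ereal.simps
      by (rule filterlim_mono[OF _ order_refl at_le[of "{..<1}" UNIV], simplified]) 
        (auto intro!: tendsto_eq_intros)
  qed (auto intro!: derivative_eq_intros continuous_intros simp: zero_ereal_def one_ereal_def power2_eq_square field_simps)
  have 2: "set_integrable lborel (einterval (-1) 0) (\<lambda>x. (ln \<bar>x\<bar>)\<^sup>2)"
  proof (rule interval_integral_FTC_nonneg(1)[where F="\<lambda>x. x * (ln (-x))\<^sup>2 - 2 * x * ln (-x) + 2 * x" and A="-2" and B=0])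
    show "(((\<lambda>x. x * (ln (-x))\<^sup>2 - 2 * x * ln (-x) + 2 * x) \<circ> real_of_ereal) \<longlongrightarrow> 0) (at_left 0)"
      unfolding zero_ereal_def at_left_ereal filterlim_filtermap o_def real_of_ereal.simps by real_asymp
    show "(((\<lambda>x. x * (ln (-x))\<^sup>2 - 2 * x * ln (-x) + 2 * x) \<circ> real_of_ereal) \<longlongrightarrow> -2) (at_right (-1))"
      unfolding one_ereal_def uminus_ereal.simps at_right_ereal filterlim_filtermap o_def real_of_ereal.simps
      by (rule filterlim_mono[OF _ order_refl at_le[of "{-1<..}" UNIV], simplified]) 
        (auto intro!: tendsto_eq_intros)
  qed (auto intro!: derivative_eq_intros continuous_intros simp: zero_ereal_def one_ereal_def power2_eq_square field_simps)
  have "set_integrable lborel (einterval (-1) 0 \<union> einterval 0 1) (\<lambda>x. (ln \<bar>x\<bar>)\<^sup>2)"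
    by (rule set_integrable_Un[OF 2 1]) auto
  then have "(\<integral>\<^sup>+x. ennreal (norm (indicat_real (einterval (-1) 0 \<union> einterval 0 1) x *\<^sub>R (ln \<bar>x\<bar>)\<^sup>2)) \<partial>lborel) < \<infinity>"
    unfolding set_integrable_def integrable_iff_bounded by blast
  also have "(\<integral>\<^sup>+x. ennreal (norm (indicat_real (einterval (-1) 0 \<union> einterval 0 1) x *\<^sub>R (ln \<bar>x\<bar>)\<^sup>2)) \<partial>lborel)
     = (\<integral>\<^sup>+x. ennreal ((ln \<bar>x\<bar>)\<^sup>2) * indicator {-1<..<1} x \<partial>lborel)"
    by (intro nn_integral_cong) (auto simp: indicator_def einterval_def zero_ereal_def one_ereal_def not_less)
  finally show ?thesis .
qed

text \<open>In the unit disc |Re z| <= |z| < 1, so \<open>ln |z|\<close> is no larger in modulus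
  than \<open>ln |Re z|\<close>. The disc lies in a square, hence the one-dimensional integral times
  the side length 2 is a bound.\<close>

lemma nn_integral_ln_square_disc:
  "(\<integral>\<^sup>+z. ennreal ((ln (cmod z))\<^sup>2) * indicator (ball 0 1) z \<partial>lborel) < \<infinity>"
proof -
  have [measurable]: "ball (0::complex) 1 \<in> sets borel" by simp
  let ?I = "(\<integral>\<^sup>+x. ennreal ((ln \<bar>x\<bar>)\<^sup>2) * indicator {-1<..<1} x \<partial>lborel)"
  have "(\<integral>\<^sup>+z. ennreal ((ln (cmod z))\<^sup>2) * indicator (ball 0 1) z \<partial>lborel) =
     (\<integral>\<^sup>+x. \<integral>\<^sup>+y. ennreal ((ln (cmod (Complex x y)))\<^sup>2) * indicator (ball 0 1) (Complex x y) \<partial>lborel \<partial>lborel)"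
    by (rule nn_integral_lborel_complex) measurable
  also have "\<dots> \<le> (\<integral>\<^sup>+x. \<integral>\<^sup>+y. ennreal ((ln \<bar>x\<bar>)\<^sup>2) * indicator {-1<..<1} x * indicator {-1<..<1::real} y \<partial>lborel \<partial>lborel)"
  proof (rule nn_integral_mono_AE)
    \<comment> \<open>The line Re z = 0 is left out because there \<open>ln 0 = 0\<close> breaks the
      monotonicity of the logarithm.\<close>
    have "AE x in lborel. x \<noteq> (0::real)" by (rule AE_lborel_singleton)
    then show "AE x in lborel. (\<integral>\<^sup>+y. ennreal ((ln (cmod (Complex x y)))\<^sup>2) * indicator (ball 0 1) (Complex x y) \<partial>lborel)
      \<le> (\<integral>\<^sup>+y. ennreal ((ln \<bar>x\<bar>)\<^sup>2) * indicator {-1<..<1} x * indicator {-1<..<1::real} y \<partial>lborel)"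
    proof eventually_elim
      case (elim x)
      show ?case
      proof (rule nn_integral_mono)
        fix y :: real
        have x: "\<bar>x\<bar> \<le> cmod (Complex x y)" and y: "\<bar>y\<bar> \<le> cmod (Complex x y)"
          using abs_Re_le_cmod[of "Complex x y"] abs_Im_le_cmod[of "Complex x y"] by auto
        show "ennreal ((ln (cmod (Complex x y)))\<^sup>2) * indicator (ball 0 1) (Complex x y)
          \<le> ennreal ((ln \<bar>x\<bar>)\<^sup>2) * indicator {-1<..<1} x * indicator {-1<..<1::real} y"
        proof (cases "cmod (Complex x y) < 1")
          case True
          have "ln \<bar>x\<bar> \<le> ln (cmod (Complex x y))" using x elim by (intro ln_mono) auto
          moreover have "ln (cmod (Complex x y)) \<le> 0" using True by (cases "cmod (Complex x y) = 0") (simp_all add: ln_le_zero_iff)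
          ultimately have "(ln (cmod (Complex x y)))\<^sup>2 \<le> (ln \<bar>x\<bar>)\<^sup>2"
            by (simp add: abs_le_square_iff[symmetric])
          with x y True show ?thesis by (auto simp: indicator_def ennreal_leI)
        qed auto
      qed
    qed
  qed
  also have "\<dots> = (\<integral>\<^sup>+x. ennreal ((ln \<bar>x\<bar>)\<^sup>2) * indicator {-1<..<1} x * 2 \<partial>lborel)"
    by (intro nn_integral_cong) (simp add: nn_integral_cmult)
  also have "\<dots> = ?I * 2" by (rule nn_integral_multc) simp
  also have "\<dots> < \<infinity>" using nn_integral_ln_square_real by (simp add: ennreal_mult_less_top)
  finally show ?thesis .
qed

section \<open>Test functions and their Laplacian\<close>

lemma fsupport_outside: "z \<notin> fsupport f \<Longrightarrow> f z = 0"
  using closure_subset[of "{x. f x \<noteq> 0}"] by (auto simp: fsupport_def)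

lemma smooth_has_derivative:
  "smooth f \<Longrightarrow> (f has_derivative (\<lambda>v. dir_deriv v f z)) (at z)"
  unfolding smooth_def dir_deriv_def
  by (drule spec[of _ 1]) (simp add: frechet_derivative_works)

lemma smooth_dir_deriv: "smooth f \<Longrightarrow> smooth (dir_deriv v f)"
  unfolding smooth_def dir_deriv_def[abs_def] by (metis times_cont_diff.simps(2))

lemma smooth_continuous_on: "smooth f \<Longrightarrow> continuous_on UNIV f"
  unfolding smooth_def by (metis times_cont_diff.simps(1))

lemma dir_deriv_outside:
  fixes f :: "'a::euclidean_space \<Rightarrow> 'b::real_normed_vector"
  assumes "smooth f" "compact K" "\<And>z. z \<notin> K \<Longrightarrow> f z = 0" "z \<notin> K"
  shows "dir_deriv v f z = 0"
  using has_derivative_zero_outside_compact[OF smooth_has_derivative[OF assms(1)] assms(2-4)]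
  by (auto dest: fun_cong)

lemma continuous_on_laplacian: "smooth \<phi> \<Longrightarrow> continuous_on UNIV (laplacian \<phi>)"
  unfolding laplacian_def[abs_def]
  by (intro continuous_intros smooth_continuous_on smooth_dir_deriv)

lemma laplacian_outside:
  assumes "smooth \<phi>" "compact (fsupport \<phi>)" "z \<notin> fsupport \<phi>"
  shows "laplacian \<phi> z = 0"
  unfolding laplacian_def
  by (simp add: dir_deriv_outside[OF smooth_dir_deriv[OF assms(1)] assms(2) _ assms(3)]
      dir_deriv_outside[OF assms(1,2) fsupport_outside[of _ \<phi>]])

lemma nn_integral_lborel_translate:
  fixes w :: "'a::euclidean_space"
  assumes [measurable]: "f \<in> borel_measurable borel"
  shows "(\<integral>\<^sup>+z. f (z - w) \<partial>lborel) = (\<integral>\<^sup>+z. f z \<partial>lborel)"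
  by (subst (2) lborel_distr_plus[of "-w", symmetric], subst nn_integral_distr) (auto)

definition ln_disc_const :: ennreal where
  "ln_disc_const = (\<integral>\<^sup>+z. ennreal ((ln (cmod z))\<^sup>2) * indicator (ball 0 1) z \<partial>lborel)"

text \<open>The set is split at distance 1 from \<open>w\<close>. By translation the singular part
  is bounded by the same constant for every \<open>w\<close>; the rest is at most
  \<open>(ln T)^2\<close>. The position of \<open>w\<close> thus costs only the logarithm of a
  distance.\<close>

lemma nn_integral_ln_square_le:
  assumes [measurable]: "K \<in> sets borel" and T: "T \<ge> 1" "\<And>z. z \<in> K \<Longrightarrow> cmod (z - w) \<le> T"
  shows "(\<integral>\<^sup>+z. ennreal ((ln (cmod (z - w)))\<^sup>2) * indicator K z \<partial>lborel)
      \<le> ln_disc_const + ennreal ((ln T)\<^sup>2) * emeasure lborel K"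
proof -
  have [measurable]: "ball (0::complex) 1 \<in> sets borel" by simp
  have "(\<integral>\<^sup>+z. ennreal ((ln (cmod (z - w)))\<^sup>2) * indicator K z \<partial>lborel)
      \<le> (\<integral>\<^sup>+z. ennreal ((ln (cmod (z - w)))\<^sup>2) * indicator (ball 0 1) (z - w)
            + ennreal ((ln T)\<^sup>2) * indicator K z \<partial>lborel)"
  proof (rule nn_integral_mono)
    fix z
    show "ennreal ((ln (cmod (z - w)))\<^sup>2) * indicator K z
      \<le> ennreal ((ln (cmod (z - w)))\<^sup>2) * indicator (ball 0 1) (z - w) + ennreal ((ln T)\<^sup>2) * indicator K z"
    proof (cases "z \<in> K \<and> cmod (z - w) \<ge> 1")
      case True
      then have "ln (cmod (z - w)) \<le> ln T" "0 \<le> ln (cmod (z - w))" using T by (auto intro!: ln_mono)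
      then have "(ln (cmod (z - w)))\<^sup>2 \<le> (ln T)\<^sup>2" by (intro power_mono)
      with True show ?thesis by (simp add: ennreal_leI add_increasing)
    next
      case False
      then show ?thesis by (auto simp: indicator_def)
    qed
  qed
  also have "\<dots> = (\<integral>\<^sup>+z. ennreal ((ln (cmod (z - w)))\<^sup>2) * indicator (ball 0 1) (z - w) \<partial>lborel)
        + ennreal ((ln T)\<^sup>2) * emeasure lborel K"
    by (subst nn_integral_add) (auto simp: nn_integral_cmult)
  also have "(\<integral>\<^sup>+z. ennreal ((ln (cmod (z - w)))\<^sup>2) * indicator (ball 0 1) (z - w) \<partial>lborel) = ln_disc_const"
    unfolding ln_disc_const_def
    by (rule nn_integral_lborel_translate[where f="\<lambda>z. ennreal ((ln (cmod z))\<^sup>2) * indicator (ball 0 1) z"]) measurable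
  finally show ?thesis .
qed

lemma integrable_mult_bounded_ln:
  fixes g :: "complex \<Rightarrow> complex"
  assumes g: "continuous_on UNIV g" "compact K" "\<And>z. z \<notin> K \<Longrightarrow> g z = 0"
  shows "integrable lborel (\<lambda>z. g z * of_real (ln (cmod (z - w))))"
proof -
  obtain B where B: "B > 0" "\<And>z. cmod (g z) \<le> B"
    using bounded_continuous_compact_support[OF g] by blast
  obtain r where r: "\<And>z. z \<in> K \<Longrightarrow> cmod z \<le> r"
    using compact_imp_bounded[OF g(2)] by (auto simp: bounded_iff)
  have [measurable]: "K \<in> sets borel" using g(2) by (simp add: compact_imp_closed)
  have [measurable]: "g \<in> borel_measurable borel"
    using g(1) by (rule borel_measurable_continuous_onI)
  have K: "emeasure lborel K < \<infinity>" by (rule emeasure_compact_finite) (rule g)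
  define T where "T = max 1 (r + cmod w)"
  have T: "T \<ge> 1" by (simp add: T_def)
  have T': "cmod (z - w) \<le> T" if "z \<in> K" for z
    using norm_triangle_ineq4[of z w] r[OF that] by (simp add: T_def)
  have "(\<integral>\<^sup>+z. ennreal (norm (g z * of_real (ln (cmod (z - w))))) \<partial>lborel)
     \<le> (\<integral>\<^sup>+z. ennreal B * (indicator K z + ennreal ((ln (cmod (z - w)))\<^sup>2) * indicator K z) \<partial>lborel)"
  proof (rule nn_integral_mono)
    fix z
    show "ennreal (norm (g z * of_real (ln (cmod (z - w))))) \<le>
      ennreal B * (indicator K z + ennreal ((ln (cmod (z - w)))\<^sup>2) * indicator K z)"
    proof (cases "z \<in> K")
      case True
      \<comment> \<open>Reduces the first moment to the second, which is already bounded.\<close>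
      have "\<bar>x\<bar> \<le> 1 + x\<^sup>2" for x :: real
        using zero_le_power2[of "\<bar>x\<bar> - 1"] zero_le_power2[of x] by (simp add: power2_diff)
      then have "norm (g z * of_real (ln (cmod (z - w)))) \<le> B * (1 + (ln (cmod (z - w)))\<^sup>2)"
        unfolding norm_mult norm_of_real using B by (intro mult_mono) (auto intro: less_imp_le)
      then have "ennreal (norm (g z * of_real (ln (cmod (z - w))))) \<le> ennreal (B * (1 + (ln (cmod (z - w)))\<^sup>2))"
        by (rule ennreal_leI)
      then show ?thesis using True B by (simp add: ennreal_mult ennreal_plus)
    qed (simp add: g)
  qed
  also have "\<dots> = ennreal B * (emeasure lborel K + (\<integral>\<^sup>+z. ennreal ((ln (cmod (z - w)))\<^sup>2) * indicator K z \<partial>lborel))"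
    by (subst nn_integral_cmult) (auto simp: nn_integral_add)
  also have "\<dots> \<le> ennreal B * (emeasure lborel K + (ln_disc_const + ennreal ((ln T)\<^sup>2) * emeasure lborel K))"
    using nn_integral_ln_square_le[OF _ T T'] by (intro mult_left_mono add_left_mono) auto
  also have "\<dots> < \<infinity>"
    using K nn_integral_ln_square_disc by (simp add: ennreal_mult_less_top ln_disc_const_def)
  finally show ?thesis by (intro integrableI_bounded) measurable
qed

section \<open>Green's identity and the fundamental solution\<close>

lemma integral_lborel_affine:
  fixes f :: "complex \<Rightarrow> complex"
  assumes [measurable]: "f \<in> borel_measurable borel" and e: "e > 0"
  shows "(LINT z|lborel. f z) = of_real (e\<^sup>2) * (LINT u|lborel. f (w + e *\<^sub>R u))"
proof -
  have "(LINT z|lborel. f z) =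
     (LINT z|density (distr lborel borel (\<lambda>x. w + e *\<^sub>R x)) (\<lambda>_. \<bar>e\<bar>^DIM(complex)). f z)"
    using e by (subst lborel_affine[of e w]) auto
  also have "\<dots> = (LINT u|lborel. (\<bar>e\<bar>^DIM(complex)) *\<^sub>R f (w + e *\<^sub>R u))"
    by (subst integral_density) (auto simp: integral_distr)
  also have "\<dots> = e\<^sup>2 * (LINT u|lborel. f (w + e *\<^sub>R u))"
    using e by (simp add: scaleR_conv_of_real)
  finally show ?thesis by simp
qed

lemma has_derivative_ln_regularized:
  fixes w :: complex
  assumes "e > 0"
  shows "((\<lambda>z. ln ((cmod (z - w))\<^sup>2 + e\<^sup>2) / 2) has_derivative
     (\<lambda>h. ((z - w) \<bullet> h) / ((cmod (z - w))\<^sup>2 + e\<^sup>2))) (at z)"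
proof -
  have q: "(z - w) \<bullet> (z - w) + e\<^sup>2 > 0" using assms by (simp add: add_nonneg_pos)
  show ?thesis unfolding power2_norm_eq_inner using q
    by (auto intro!: derivative_eq_intros simp: inner_commute field_simps)
qed

lemma has_derivative_ln_regularized2:
  fixes w :: complex
  assumes "e > 0"
  shows "((\<lambda>z. ((z - w) \<bullet> v) / ((cmod (z - w))\<^sup>2 + e\<^sup>2)) has_derivative
     (\<lambda>h. (h \<bullet> v) / ((cmod (z - w))\<^sup>2 + e\<^sup>2) -
        2 * ((z - w) \<bullet> v) * ((z - w) \<bullet> h) / ((cmod (z - w))\<^sup>2 + e\<^sup>2)\<^sup>2)) (at z)"
proof -
  have q: "(z - w) \<bullet> (z - w) + e\<^sup>2 > 0" using assms by (simp add: add_nonneg_pos)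
  show ?thesis unfolding power2_norm_eq_inner using q
    by (auto intro!: derivative_eq_intros simp: inner_commute power2_eq_square[of "_ + _"] fun_eq_iff divide_simps)
qed

text \<open>With F the regularised logarithm, the function D_v \<phi> * F - \<phi> * D_v F has
  compact support, so its derivative along v integrates to zero; the mixed products cancel. Adding v
  = 1 and v = \<i> moves the Laplacian from \<phi> to F, and the Laplacian of F is the kernel on the
  right.\<close>

lemma green_ln_regularized:
  assumes \<phi>: "smooth \<phi>" "compact (fsupport \<phi>)" and e: "e > 0"
  shows "(LINT z|lborel. laplacian \<phi> z * of_real (ln ((cmod (z - w))\<^sup>2 + e\<^sup>2) / 2)) =
    (LINT z|lborel. \<phi> z * of_real (2 * e\<^sup>2 / ((cmod (z - w))\<^sup>2 + e\<^sup>2)\<^sup>2))"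
proof -
  define F where "F z = ln ((cmod (z - w))\<^sup>2 + e\<^sup>2) / 2" for z
  define q where "q z = (cmod (z - w))\<^sup>2 + e\<^sup>2" for z
  have q: "q z > 0" for z using e by (simp add: q_def add_nonneg_pos)
  then have q0: "q z \<noteq> 0" for z by (metis less_irrefl)
  \<comment> \<open>\<open>H v\<close> is the second derivative of \<open>F\<close> along
    \<open>v\<close>, and \<open>R v\<close> is the derivative along \<open>v\<close> of the
    function \<open>G\<close> introduced below.\<close>
  define H where "H v z = v \<bullet> v / q z - 2 * ((z - w) \<bullet> v)\<^sup>2 / (q z)\<^sup>2" for v z
  define R where "R v z = dir_deriv v (dir_deriv v \<phi>) z * of_real (F z) - \<phi> z * of_real (H v z)" for v z
  note out = fsupport_outside[of _ \<phi>] dir_deriv_outside[OF \<phi>(1,2) fsupport_outside[of _ \<phi>]]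
  note out2 = dir_deriv_outside[OF smooth_dir_deriv[OF \<phi>(1)] \<phi>(2) out(2)]
  have cq: "continuous_on UNIV q" unfolding q_def by (intro continuous_intros)
  have cF: "continuous_on UNIV F"
    unfolding F_def q_def[symmetric] using q0 by (intro continuous_intros cq) auto
  have cH: "continuous_on UNIV (H v)" for v
    unfolding H_def[abs_def] using q0 by (intro continuous_intros cq) auto
  have cR: "continuous_on UNIV (R v)" for v
    unfolding R_def[abs_def]
    by (intro continuous_intros cF cH smooth_continuous_on smooth_dir_deriv \<phi>)
  have R0: "(LINT z|lborel. R v z) = 0" for v
  proof -
    define G where "G z = dir_deriv v \<phi> z * of_real (F z) - \<phi> z * of_real (((z - w) \<bullet> v) / q z)" for z
    define G' where "G' z h = (dir_deriv v \<phi> z * of_real (((z - w) \<bullet> h) / q z) + dir_deriv h (dir_deriv v \<phi>) z * of_real (F z))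
       - (\<phi> z * of_real ((h \<bullet> v) / q z - 2 * ((z - w) \<bullet> v) * ((z - w) \<bullet> h) / (q z)\<^sup>2)
         + dir_deriv h \<phi> z * of_real (((z - w) \<bullet> v) / q z))" for z h
    have eq: "G' z v = R v z" for z
      by (simp add: G'_def R_def H_def power2_eq_square algebra_simps)
    have "(LINT z|lborel. G' z v) = 0"
    proof (rule integral_directional_derivative_eq_0[OF _ _ \<phi>(2)])
      show "(G has_derivative G' z) (at z)" for z
        unfolding G_def[abs_def] G'_def[abs_def] F_def q_def
        by (intro has_derivative_diff has_derivative_mult has_derivative_of_real smooth_has_derivative
            smooth_dir_deriv \<phi> has_derivative_ln_regularized has_derivative_ln_regularized2 e)
      show "continuous_on UNIV (\<lambda>z. G' z v)" unfolding eq using cR .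
      show "G z = 0" if "z \<notin> fsupport \<phi>" for z
        using that by (simp add: G_def out)
    qed
    then show ?thesis unfolding eq .
  qed
  have intR: "integrable lborel (R v)" for v
    by (rule integrable_continuous_compact_support[OF cR \<phi>(2)]) (simp add: R_def out out2)
  have sum: "R 1 z + R \<i> z = laplacian \<phi> z * of_real (F z) - \<phi> z * of_real (2 * e\<^sup>2 / (q z)\<^sup>2)" for z
  proof -
    have "H 1 z + H \<i> z = 2 / q z - 2 * (cmod (z - w))\<^sup>2 / (q z)\<^sup>2"
      by (simp add: H_def inner_complex_def cmod_power2 add_divide_distrib algebra_simps)
    also have "\<dots> = 2 * e\<^sup>2 / (q z)\<^sup>2"
    proof -
      have "2 / q z = 2 * q z / (q z)\<^sup>2" using q0[of z] by (simp add: power2_eq_square)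
      then have "2 / q z - 2 * (cmod (z - w))\<^sup>2 / (q z)\<^sup>2 = (2 * q z - 2 * (cmod (z - w))\<^sup>2) / (q z)\<^sup>2"
        by (simp only: diff_divide_distrib)
      also have "2 * q z - 2 * (cmod (z - w))\<^sup>2 = 2 * e\<^sup>2" by (simp add: q_def)
      finally show ?thesis .
    qed
    finally have H: "H \<i> z = 2 * e\<^sup>2 / (q z)\<^sup>2 - H 1 z" by simp
    show ?thesis unfolding R_def laplacian_def H by (simp add: algebra_simps)
  qed
  have i1: "integrable lborel (\<lambda>z. laplacian \<phi> z * of_real (F z))"
    by (rule integrable_continuous_compact_support[OF _ \<phi>(2)])
      (auto intro!: continuous_intros cF continuous_on_laplacian \<phi> simp: laplacian_outside[OF \<phi>])
  have i2: "integrable lborel (\<lambda>z. \<phi> z * of_real (2 * e\<^sup>2 / (q z)\<^sup>2))"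
    by (rule integrable_continuous_compact_support[OF _ \<phi>(2)])
      (use q0 in \<open>auto intro!: continuous_intros cq smooth_continuous_on[OF \<phi>(1)] simp: out simp del: of_real_divide\<close>)
  have "(LINT z|lborel. laplacian \<phi> z * of_real (F z) - \<phi> z * of_real (2 * e\<^sup>2 / (q z)\<^sup>2)) = 0"
    unfolding sum[symmetric] using R0 intR by simp
  then show ?thesis using i1 i2 by (simp add: F_def q_def)
qed

text \<open>Substituting z = w + e u in the regularised identity turns its right-hand side into an
  integral of \<open>\<phi> (w + e u)\<close> against a fixed kernel of mass \<open>2 * pi\<close>.
  As e tends to 0, continuity of \<phi> gives the value at \<open>w\<close>.\<close>

lemma integral_laplacian_ln:
  assumes \<phi>: "smooth \<phi>" "compact (fsupport \<phi>)"
  shows "(LINT z|lborel. laplacian \<phi> z * of_real (ln (cmod (z - w)))) = 2 * of_real pi * \<phi> w"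
proof -
  define e where "e n = 1 / (real n + 1)" for n
  have e: "e n > 0" "e n \<le> 1" for n by (auto simp: e_def)
  have e0: "e \<longlonglongrightarrow> 0" unfolding e_def by real_asymp
  have [measurable]: "laplacian \<phi> \<in> borel_measurable borel" "\<phi> \<in> borel_measurable borel"
    by (intro borel_measurable_continuous_onI continuous_on_laplacian smooth_continuous_on \<phi>)+
  let ?F = "\<lambda>e z. ln ((cmod (z - w))\<^sup>2 + e\<^sup>2) / 2"
  have lim1: "(\<lambda>n. LINT z|lborel. laplacian \<phi> z * of_real (?F (e n) z)) \<longlonglongrightarrow>
     (LINT z|lborel. laplacian \<phi> z * of_real (ln (cmod (z - w))))"
  \<comment> \<open>As \<open>e n <= 1\<close>, the regularised logarithm lies between
    \<open>ln (cmod (z - w))\<close> and its own value at e = 1, so the two absolute values together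
    dominate it.\<close>
  proof (rule integral_dominated_convergence[where
      w="\<lambda>z. norm (laplacian \<phi> z * of_real (ln (cmod (z - w)))) + norm (laplacian \<phi> z * of_real (?F 1 z))"])
    have "continuous_on UNIV (\<lambda>z. laplacian \<phi> z * of_real (?F 1 z))"
    proof -
      have "(cmod (z - w))\<^sup>2 + 1 \<noteq> 0" for z by (smt (verit) zero_le_power2)
      then show ?thesis by (auto intro!: continuous_intros continuous_on_laplacian \<phi>)
    qed
    then have "integrable lborel (\<lambda>z. laplacian \<phi> z * of_real (?F 1 z))"
      by (rule integrable_continuous_compact_support[OF _ \<phi>(2)]) (simp add: laplacian_outside[OF \<phi>])
    moreover have "integrable lborel (\<lambda>z. laplacian \<phi> z * of_real (ln (cmod (z - w))))"
      by (rule integrable_mult_bounded_ln[OF continuous_on_laplacian[OF \<phi>(1)] \<phi>(2) laplacian_outside[OF \<phi>]])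
    ultimately show "integrable lborel (\<lambda>z. norm (laplacian \<phi> z * of_real (ln (cmod (z - w))))
        + norm (laplacian \<phi> z * of_real (?F 1 z)))"
      by (intro Bochner_Integration.integrable_add integrable_norm)
    have ne: "AE z in lborel. z \<noteq> w" by (rule AE_lborel_singleton)
    then show "AE z in lborel. (\<lambda>n. laplacian \<phi> z * of_real (?F (e n) z)) \<longlonglongrightarrow> laplacian \<phi> z * of_real (ln (cmod (z - w)))"
    proof eventually_elim
      case (elim z)
      have "(\<lambda>n. ?F (e n) z) \<longlonglongrightarrow> ln ((cmod (z - w))\<^sup>2 + 0\<^sup>2) / 2"
        using elim by (intro tendsto_intros e0) auto
      moreover have "ln ((cmod (z - w))\<^sup>2 + 0\<^sup>2) / 2 = ln (cmod (z - w))"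
        using elim by (simp add: ln_realpow)
      ultimately show ?case by (intro tendsto_intros) auto
    qed
    from ne show "AE z in lborel. norm (laplacian \<phi> z * of_real (?F (e n) z)) \<le>
       norm (laplacian \<phi> z * of_real (ln (cmod (z - w)))) + norm (laplacian \<phi> z * of_real (?F 1 z))" for n
    proof eventually_elim
      case (elim z)
      then have c: "cmod (z - w) > 0" by simp
      have "ln (cmod (z - w)) = ln ((cmod (z - w))\<^sup>2) / 2" using c by (simp add: ln_realpow)
      also have "\<dots> \<le> ?F (e n) z" using c by (intro divide_right_mono ln_mono) auto
      finally have 1: "ln (cmod (z - w)) \<le> ?F (e n) z" .
      have "(e n)\<^sup>2 \<le> 1" using e[of n] by (simp add: power_le_one)
      then have 2: "?F (e n) z \<le> ?F 1 z" using c by (intro divide_right_mono ln_mono) (auto simp: add_pos_nonneg)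
      from 1 2 have "\<bar>?F (e n) z\<bar> \<le> \<bar>ln (cmod (z - w))\<bar> + \<bar>?F 1 z\<bar>" by linarith
      then have "cmod (laplacian \<phi> z) * \<bar>?F (e n) z\<bar> \<le> cmod (laplacian \<phi> z) * (\<bar>ln (cmod (z - w))\<bar> + \<bar>?F 1 z\<bar>)"
        by (rule mult_left_mono) simp
      then show ?case unfolding norm_mult norm_of_real by (simp only: distrib_left)
    qed
  qed measurable
  obtain B where B: "B > 0" "\<And>z. cmod (\<phi> z) \<le> B"
    using bounded_continuous_compact_support[OF smooth_continuous_on[OF \<phi>(1)] \<phi>(2) fsupport_outside[of _ \<phi>]] by blast
  let ?P = "\<lambda>u. 2 / (1 + (cmod u)\<^sup>2)\<^sup>2"
  have P: "integrable lborel ?P" "(LINT u|lborel. ?P u) = 2 * pi"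
  proof -
    show i: "integrable lborel ?P"
      by (rule integrableI_bounded) (simp_all add: nn_integral_poisson_square)
    have "ennreal (LINT u|lborel. ?P u) = ennreal (2 * pi)"
      using nn_integral_eq_integral[OF i] nn_integral_poisson_square by simp
    then show "(LINT u|lborel. ?P u) = 2 * pi" by (simp add: integral_nonneg_AE)
  qed
  have lim2: "(\<lambda>n. LINT u|lborel. \<phi> (w + e n *\<^sub>R u) * of_real (?P u)) \<longlonglongrightarrow> (LINT u|lborel. \<phi> w * of_real (?P u))"
  proof (rule integral_dominated_convergence[where w="\<lambda>u. B * ?P u"])
    show "integrable lborel (\<lambda>u. B * ?P u)" using P(1) by (rule integrable_mult_right)
    have "isCont \<phi> w" using smooth_continuous_on[OF \<phi>(1)] by (simp add: continuous_on_eq_continuous_at)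
    then have "(\<lambda>n. \<phi> (w + e n *\<^sub>R u)) \<longlonglongrightarrow> \<phi> w" for u
    proof (rule isCont_tendsto_compose)
      have "(\<lambda>n. w + e n *\<^sub>R u) \<longlonglongrightarrow> w + 0 *\<^sub>R u" by (intro tendsto_intros e0)
      then show "(\<lambda>n. w + e n *\<^sub>R u) \<longlonglongrightarrow> w" by simp
    qed
    then show "AE u in lborel. (\<lambda>n. \<phi> (w + e n *\<^sub>R u) * of_real (?P u)) \<longlonglongrightarrow> \<phi> w * of_real (?P u)"
      by (intro AE_I2 tendsto_mult tendsto_const)
    show "AE u in lborel. norm (\<phi> (w + e n *\<^sub>R u) * of_real (?P u)) \<le> B * ?P u" for n
      unfolding norm_mult norm_of_real using B by (intro AE_I2 mult_mono) auto
  qed measurable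
  have eq: "(LINT z|lborel. laplacian \<phi> z * of_real (?F (e n) z)) =
      (LINT u|lborel. \<phi> (w + e n *\<^sub>R u) * of_real (?P u))" for n
  proof -
    have e': "e n \<noteq> 0" using e[of n] by simp
    have "(LINT z|lborel. laplacian \<phi> z * of_real (?F (e n) z)) =
      (LINT z|lborel. \<phi> z * of_real (2 * (e n)\<^sup>2 / ((cmod (z - w))\<^sup>2 + (e n)\<^sup>2)\<^sup>2))"
      by (rule green_ln_regularized[OF \<phi> e(1)])
    \<comment> \<open>The Jacobian \<open>(e n)^2\<close> of the plane is precisely the factor that
      makes the rescaled kernel independent of \<open>n\<close>.\<close>
    also have "\<dots> = (e n)\<^sup>2 * (LINT u|lborel. \<phi> (w + e n *\<^sub>R u) *
         of_real (2 * (e n)\<^sup>2 / ((cmod (w + e n *\<^sub>R u - w))\<^sup>2 + (e n)\<^sup>2)\<^sup>2))"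
      by (rule integral_lborel_affine[OF _ e(1)]) measurable
    also have "\<dots> = (LINT u|lborel. (e n)\<^sup>2 * (\<phi> (w + e n *\<^sub>R u) *
         of_real (2 * (e n)\<^sup>2 / ((cmod (w + e n *\<^sub>R u - w))\<^sup>2 + (e n)\<^sup>2)\<^sup>2)))"
      by (rule integral_mult_right_zero[symmetric])
    also have "\<dots> = (LINT u|lborel. \<phi> (w + e n *\<^sub>R u) * of_real (?P u))"
    proof (rule Bochner_Integration.integral_cong[OF refl])
      fix u
      have "(cmod (w + e n *\<^sub>R u - w))\<^sup>2 + (e n)\<^sup>2 = (e n)\<^sup>2 * (1 + (cmod u)\<^sup>2)"
        using e(1)[of n] by (simp add: power_mult_distrib algebra_simps)
      then have "(e n)\<^sup>2 * (2 * (e n)\<^sup>2 / ((cmod (w + e n *\<^sub>R u - w))\<^sup>2 + (e n)\<^sup>2)\<^sup>2) = ?P u"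
        using e' by (simp add: power_mult_distrib power2_eq_square)
      then have "of_real ((e n)\<^sup>2 * (2 * (e n)\<^sup>2 / ((cmod (w + e n *\<^sub>R u - w))\<^sup>2 + (e n)\<^sup>2)\<^sup>2)) = (of_real (?P u) :: complex)"
        by (rule arg_cong)
      then show "(e n)\<^sup>2 * (\<phi> (w + e n *\<^sub>R u) *
         of_real (2 * (e n)\<^sup>2 / ((cmod (w + e n *\<^sub>R u - w))\<^sup>2 + (e n)\<^sup>2)\<^sup>2)) = \<phi> (w + e n *\<^sub>R u) * of_real (?P u)"
        by (subst mult.left_commute) (simp only: of_real_mult)
    qed
    finally show ?thesis .
  qed
  have "(LINT z|lborel. laplacian \<phi> z * of_real (ln (cmod (z - w)))) = (LINT u|lborel. \<phi> w * of_real (?P u))"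
    using LIMSEQ_unique[OF lim1 lim2[folded eq]] .
  also have "\<dots> = \<phi> w * of_real (LINT u|lborel. ?P u)" using P(1) by (simp only: integral_mult_right_zero integral_complex_of_real)
  finally show ?thesis unfolding P by (simp add: mult.commute)
qed

section \<open>Sums of monic polynomials\<close>

lemma poly_rand_poly: "poly (rand_poly X n k \<omega>) z = (\<Prod>i=1..n. z - X i k \<omega>)"
  by (simp add: rand_poly_def poly_prod)

text \<open>Monic summands of equal degree cannot cancel in the top coefficient. This fixes the
  number of zeros, and the factor \<open>m\<close> is the origin of the \<open>ln m\<close>
  subtracted in \<open>f\<close>.\<close>

lemma sum_rand_poly:
  assumes "m \<ge> 1"
  shows "degree (\<Sum>k=1..m. rand_poly X n k \<omega>) = n" "lead_coeff (\<Sum>k=1..m. rand_poly X n k \<omega>) = of_nat m"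
proof -
  have d: "degree (rand_poly X n k \<omega>) = n" for k
    by (simp add: rand_poly_def degree_prod_sum_eq)
  have l: "coeff (rand_poly X n k \<omega>) n = 1" for k
    using lead_coeff_prod[of "\<lambda>i. [:- X i k \<omega>, 1:]" "{1..n}"] d[of k] by (simp add: rand_poly_def)
  have c: "coeff (\<Sum>k=1..m. rand_poly X n k \<omega>) n = of_nat m"
    by (simp add: coeff_sum l)
  have "degree (\<Sum>k=1..m. rand_poly X n k \<omega>) \<le> n"
    by (rule degree_sum_le) (simp_all add: d)
  moreover have "n \<le> degree (\<Sum>k=1..m. rand_poly X n k \<omega>)"
    using c assms by (intro le_degree) simp
  ultimately show "degree (\<Sum>k=1..m. rand_poly X n k \<omega>) = n" by simp
  with c show "lead_coeff (\<Sum>k=1..m. rand_poly X n k \<omega>) = of_nat m" by simp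
qed

text \<open>Listing the multiset of zeros turns multiplicities into repeated indices, so that the
  factorisation and the sum over zeros use the same \<open>n\<close> points.\<close>

lemma sum_rand_poly_roots:
  assumes "m \<ge> 1"
  obtains r :: "nat \<Rightarrow> complex" where
    "\<And>z. poly (\<Sum>k=1..m. rand_poly X n k \<omega>) z = of_nat m * (\<Prod>i<n. z - r i)"
    "\<And>f :: complex \<Rightarrow> complex. (\<Sum>z\<in>#proots (\<Sum>k=1..m. rand_poly X n k \<omega>). f z) = (\<Sum>i<n. f (r i))"
proof -
  let ?P = "\<Sum>k=1..m. rand_poly X n k \<omega>"
  obtain xs where xs: "mset xs = proots ?P" using ex_mset by blast
  have len: "length xs = n"
    using size_proots_complex[of ?P] sum_rand_poly(1)[OF assms] xs by (metis size_mset)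
  have p: "?P = smult (of_nat m) (\<Prod>x\<leftarrow>xs. [:-x, 1:])"
    using complex_poly_decompose_multiset[of ?P] sum_rand_poly(2)[OF assms] xs
    by (metis mset_map prod_mset_prod_list)
  show ?thesis
  proof
    show "poly ?P z = of_nat m * (\<Prod>i<n. z - xs ! i)" for z
      by (subst p) (simp add: poly_prod_list poly_prod prod.list_conv_set_nth len atLeast0LessThan)
    show "(\<Sum>z\<in>#proots ?P. f z) = (\<Sum>i<n. f (xs ! i))" for f :: "complex \<Rightarrow> complex"
      unfolding xs[symmetric]
      by (simp add: sum_mset_sum_list sum_list_sum_nth len atLeast0LessThan del: mset_map flip: mset_map)
  qed
qed

text \<open>Beyond radius \<open>2 n R\<close> every \<open>p\<^sub>k(z) / z\<^sup>n\<close> has distance less than 1 from 1, so the sum cannot vanish.\<close>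

lemma sum_rand_poly_root_bound:
  fixes R :: real
  assumes m: "m \<ge> 1" and n: "n \<ge> 1" and R: "R > 0"
    and X: "\<And>i k. i \<in> {1..n} \<Longrightarrow> k \<in> {1..m} \<Longrightarrow> cmod (X i k \<omega>) \<le> R"
    and root: "poly (\<Sum>k=1..m. rand_poly X n k \<omega>) z = 0"
  shows "cmod z \<le> 2 * real n * R"
proof (rule ccontr)
  assume "\<not> cmod z \<le> 2 * real n * R"
  then have z: "cmod z > 2 * real n * R" by simp
  moreover have "2 * real n * R \<ge> 0" using R by simp
  ultimately have z0: "z \<noteq> 0" by auto
  \<comment> \<open>The open unit disc about 1 lies in the right half-plane, and positivity of real
    parts survives the summation over \<open>k\<close>.\<close>
  have "Re (\<Prod>i=1..n. 1 - X i k \<omega> / z) > 0" if k: "k \<in> {1..m}" for k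
  proof -
    have *: "cmod ((\<Prod>i=1..n. 1 + (- X i k \<omega> / z)) - 1) \<le> (\<Prod>i=1..n. 1 + cmod (- X i k \<omega> / z)) - 1"
      by (rule norm_prod_minus1_le_prod_minus1)
    \<comment> \<open>Each factor deviates from 1 by at most R / (2 n R) = 1 / (2 n), so the product
      stays below exp (1 / 2) < 2. This is where the 2 in the radius comes from.\<close>
    have "(\<Prod>i=1..n. 1 + cmod (- X i k \<omega> / z)) \<le> (\<Prod>i=1..n. exp (1 / (2 * n)))"
    proof (intro prod_mono conjI)
      fix i assume i: "i \<in> {1..n}"
      have "cmod (- X i k \<omega> / z) \<le> R / (2 * real n * R)"
        unfolding norm_divide norm_minus_cancel using X[OF i k] z R n by (intro frac_le) auto
      also have "\<dots> = 1 / (2 * n)" using R n by (simp add: field_simps)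
      finally have *: "cmod (- X i k \<omega> / z) \<le> 1 / (2 * n)" .
      have "1 + cmod (- X i k \<omega> / z) \<le> exp (cmod (- X i k \<omega> / z))" by (rule exp_ge_add_one_self)
      also have "\<dots> \<le> exp (1 / (2 * n))" using * by simp
      finally show "1 + cmod (- X i k \<omega> / z) \<le> exp (1 / (2 * n))" .
    qed auto
    also have "\<dots> = exp (n * (1 / (2 * n)))"
      by (subst exp_of_nat_mult) simp
    also have "\<dots> = exp (1 / 2)" using n by simp
    also have "\<dots> < (2::real)"
    proof -
      have "1 / 2 < ln (2::real)" using ln_2_less_1 ln2_ge_two_thirds by simp
      then show ?thesis by (metis exp_less_cancel_iff exp_ln zero_less_numeral)
    qed
    finally have "cmod ((\<Prod>i=1..n. 1 + (- X i k \<omega> / z)) - 1) < 1" using * by linarith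
    then have "cmod ((\<Prod>i=1..n. 1 - X i k \<omega> / z) - 1) < 1" by simp
    then have "\<bar>Re ((\<Prod>i=1..n. 1 - X i k \<omega> / z) - 1)\<bar> < 1"
      using abs_Re_le_cmod le_less_trans by blast
    then show ?thesis by simp
  qed
  then have "(\<Sum>k=1..m. Re (\<Prod>i=1..n. 1 - X i k \<omega> / z)) > 0"
    using m by (intro sum_pos) auto
  then have "(\<Sum>k=1..m. \<Prod>i=1..n. 1 - X i k \<omega> / z) \<noteq> 0" by (auto simp flip: Re_sum)
  moreover have "poly (\<Sum>k=1..m. rand_poly X n k \<omega>) z = z ^ n * (\<Sum>k=1..m. \<Prod>i=1..n. 1 - X i k \<omega> / z)"
  proof -
    have "(\<Prod>i=1..n. z - X i k \<omega>) = z ^ n * (\<Prod>i=1..n. 1 - X i k \<omega> / z)" for k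
    proof -
      have "(\<Prod>i=1..n. z - X i k \<omega>) = (\<Prod>i=1..n. z * (1 - X i k \<omega> / z))"
        using z0 by (intro prod.cong) (auto simp: field_simps)
      then show ?thesis by (simp add: prod.distrib)
    qed
    then show ?thesis by (simp add: poly_sum poly_rand_poly sum_distrib_left)
  qed
  ultimately show False using root z0 by simp
qed

text \<open>In decreasing order every term is less than half its predecessor, so the sum is bounded
  by B (1/2 + 1/4 + ...) cut after \<open>card S\<close> terms. The induction removes the largest
  term; the missing \<open>(1/2) ^ card S\<close> is what later keeps a difference positive.\<close>

lemma separated_sum_le:
  fixes a :: "'k \<Rightarrow> real"
  assumes "finite S" "\<And>k. k \<in> S \<Longrightarrow> a k > 0"
    "\<And>k l. k \<in> S \<Longrightarrow> l \<in> S \<Longrightarrow> k \<noteq> l \<Longrightarrow> \<not> (1 / 2 \<le> a k / a l \<and> a k / a l \<le> 2)"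
    "\<And>k. k \<in> S \<Longrightarrow> a k \<le> B / 2"
  shows "(\<Sum>k\<in>S. a k) \<le> B * (1 - (1 / 2) ^ card S)"
  using assms
proof (induction "card S" arbitrary: S B)
  case 0
  then show ?case by simp
next
  case (Suc s)
  then have ne: "S \<noteq> {}" by auto
  obtain k where k: "k \<in> S" "\<And>l. l \<in> S \<Longrightarrow> a l \<le> a k"
  proof -
    have "Max (a ` S) \<in> a ` S" using ne Suc.prems(1) by (intro Max_in) auto
    then obtain k where "k \<in> S" "a k = Max (a ` S)" by auto
    moreover have "a l \<le> Max (a ` S)" if "l \<in> S" for l using that Suc.prems(1) by auto
    ultimately show ?thesis using that by metis
  qed
  have card: "card (S - {k}) = s" using k(1) Suc.hyps(2) Suc.prems(1) by simp
  have "(\<Sum>l\<in>S - {k}. a l) \<le> a k * (1 - (1 / 2) ^ card (S - {k}))"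
  proof (rule Suc.hyps(1))
    show "a l \<le> a k / 2" if "l \<in> S - {k}" for l
    proof -
      have "\<not> (1 / 2 \<le> a l / a k \<and> a l / a k \<le> 2)" using Suc.prems(3)[of l k] k(1) that by auto
      moreover have "a l / a k \<le> 1" using k(2)[of l] that Suc.prems(2)[OF k(1)] by simp
      ultimately have "a l / a k < 1 / 2" by linarith
      then show ?thesis using Suc.prems(2)[OF k(1)] by (simp add: divide_less_eq)
    qed
  qed (use Suc.prems card in auto)
  then have "(\<Sum>l\<in>S. a l) \<le> a k * (2 - (1 / 2) ^ s)"
    using sum.remove[OF Suc.prems(1) k(1), of a] card by (simp add: algebra_simps)
  also have "\<dots> \<le> B / 2 * (2 - (1 / 2) ^ s)"
    using Suc.prems(4)[OF k(1)] by (intro mult_right_mono) (auto simp: power_le_one intro: order_trans[of _ 1])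
  also have "\<dots> = B * (1 - (1 / 2) ^ card S)" using Suc.hyps(2)[symmetric] by (simp add: algebra_simps)
  finally show ?case .
qed

text \<open>If A is the largest modulus, the other terms together have at most
  \<open>A * (1 - (1/2) ^ (m - 1))\<close>, so the triangle inequality leaves at least
  \<open>A * (1/2) ^ (m - 1)\<close>. Separation by a factor 2 is what keeps a geometric tail below
  its leading term for every \<open>m\<close>.\<close>

lemma ln_sum_separated:
  fixes a :: "nat \<Rightarrow> complex"
  assumes m: "m \<ge> 1" and nz: "\<And>k. k \<in> {1..m} \<Longrightarrow> a k \<noteq> 0"
    and sep: "\<And>k l. k \<in> {1..m} \<Longrightarrow> l \<in> {1..m} - {k} \<Longrightarrow> \<not> (1 / 2 \<le> cmod (a k / a l) \<and> cmod (a k / a l) \<le> 2)"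
  shows "\<bar>ln (cmod (\<Sum>k=1..m. a k)) - (MAX k\<in>{1..m}. ln (cmod (a k)))\<bar> \<le> m * ln 2"
proof -
  have ne: "{1..m} \<noteq> {}" using m by simp
  obtain k where k: "k \<in> {1..m}" "\<And>l. l \<in> {1..m} \<Longrightarrow> cmod (a l) \<le> cmod (a k)"
  proof -
    have "Max ((cmod \<circ> a) ` {1..m}) \<in> (cmod \<circ> a) ` {1..m}" using ne by (intro Max_in) auto
    then obtain k where "k \<in> {1..m}" "cmod (a k) = Max ((cmod \<circ> a) ` {1..m})" by auto
    moreover have "cmod (a l) \<le> Max ((cmod \<circ> a) ` {1..m})" if "l \<in> {1..m}" for l using that by auto
    ultimately show ?thesis using that by metis
  qed
  let ?A = "cmod (a k)"
  have A: "?A > 0" using nz k by simp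
  have max: "(MAX k\<in>{1..m}. ln (cmod (a k))) = ln ?A"
    using k nz by (intro Max_eqI) (auto intro!: ln_mono)
  have "(\<Sum>l\<in>{1..m} - {k}. cmod (a l)) \<le> ?A * (1 - (1 / 2) ^ card ({1..m} - {k}))"
  proof (rule separated_sum_le)
    show "cmod (a l) \<le> ?A / 2" if "l \<in> {1..m} - {k}" for l
    proof -
      have "\<not> (1 / 2 \<le> cmod (a l) / ?A \<and> cmod (a l) / ?A \<le> 2)"
        using sep[of l k] k(1) that by (auto simp: norm_divide)
      moreover have "cmod (a l) / ?A \<le> 1" using k(2)[of l] that A by simp
      ultimately have "cmod (a l) / ?A < 1 / 2" by linarith
      then show ?thesis using A by (simp add: divide_less_eq)
    qed
  qed (use nz sep in \<open>auto simp: norm_divide\<close>)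
  also have "card ({1..m} - {k}) = m - 1" using k by simp
  finally have rest: "(\<Sum>l\<in>{1..m} - {k}. cmod (a l)) \<le> ?A * (1 - (1 / 2) ^ (m - 1))" .
  have split: "(\<Sum>k=1..m. a k) = a k + (\<Sum>l\<in>{1..m} - {k}. a l)"
    using k by (intro sum.remove) auto
  have n: "cmod (\<Sum>l\<in>{1..m} - {k}. a l) \<le> ?A * (1 - (1 / 2) ^ (m - 1))"
    using rest norm_sum order_trans by blast
  have "cmod (\<Sum>k=1..m. a k) \<le> ?A + ?A * (1 - (1 / 2) ^ (m - 1))"
    unfolding split using norm_triangle_ineq n by (meson add_left_mono order_trans)
  \<comment> \<open>The bound \<open>2 * A\<close> is weakened so that the upper and lower estimates
    give the same error \<open>m * ln 2\<close>.\<close>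
  also have "\<dots> \<le> ?A * 2 ^ m"
  proof -
    have "2 - (1 / 2) ^ (m - 1) \<le> (2::real)" by simp
    also have "\<dots> \<le> 2 ^ m" using m by (simp add: self_le_power)
    finally show ?thesis using mult_left_mono[of _ "2 ^ m" ?A] A by (fastforce simp: algebra_simps)
  qed
  finally have up: "cmod (\<Sum>k=1..m. a k) \<le> ?A * 2 ^ m" .
  have "?A * (1 / 2) ^ m \<le> ?A * (1 / 2) ^ (m - 1)" using A by (intro mult_left_mono power_decreasing) auto
  also have "\<dots> \<le> cmod (\<Sum>k=1..m. a k)"
    unfolding split using norm_diff_ineq[of "a k" "\<Sum>l\<in>{1..m} - {k}. a l"] n by (simp add: algebra_simps)
  finally have lo: "?A * (1 / 2) ^ m \<le> cmod (\<Sum>k=1..m. a k)" .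
  have pos: "?A * (1 / 2) ^ m > 0" using A by simp
  have "ln (?A * (1 / 2) ^ m) \<le> ln (cmod (\<Sum>k=1..m. a k))" using lo pos by (intro ln_mono) auto
  moreover have "ln (cmod (\<Sum>k=1..m. a k)) \<le> ln (?A * 2 ^ m)" using up lo pos by (intro ln_mono) auto
  moreover have "ln (?A * (1 / 2) ^ m) = ln ?A - m * ln 2"
    using A by (simp add: ln_mult ln_realpow ln_div)
  moreover have "ln (?A * 2 ^ m) = ln ?A + m * ln 2"
    using A by (simp add: ln_mult ln_realpow)
  ultimately show ?thesis unfolding max by (simp add: abs_le_iff)
qed

section \<open>Inequalities for maxima, means and squares\<close>

lemma abs_Max_diff_le:
  fixes a b :: "'k \<Rightarrow> real"
  assumes "finite S" "S \<noteq> {}"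
  shows "\<bar>(MAX k\<in>S. a k) - (MAX k\<in>S. b k)\<bar> \<le> (\<Sum>k\<in>S. \<bar>a k - b k\<bar>)"
proof -
  have *: "(MAX k\<in>S. a k) - (MAX k\<in>S. b k) \<le> (\<Sum>k\<in>S. \<bar>a k - b k\<bar>)" for a b :: "'k \<Rightarrow> real"
  proof -
    have "(MAX k\<in>S. a k) \<in> a ` S" using assms by (intro Max_in) auto
    then obtain k where k: "k \<in> S" "(MAX k\<in>S. a k) = a k" by auto
    have "a k - b k \<le> (\<Sum>k\<in>S. \<bar>a k - b k\<bar>)"
      using member_le_sum[OF k(1), of "\<lambda>k. \<bar>a k - b k\<bar>"] assms by auto
    moreover have "b k \<le> (MAX k\<in>S. b k)" using k assms by auto
    ultimately show ?thesis using k by linarith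
  qed
  from *[of a b] *[of b a] show ?thesis by (simp add: abs_le_iff abs_minus_commute)
qed

lemma Max_power2_le_sum:
  fixes a :: "'k \<Rightarrow> real"
  assumes "finite S" "S \<noteq> {}"
  shows "(MAX k\<in>S. a k)\<^sup>2 \<le> (\<Sum>k\<in>S. (a k)\<^sup>2)"
proof -
  have "(MAX k\<in>S. a k) \<in> a ` S" using assms by (intro Max_in) auto
  then obtain k where "k \<in> S" "(MAX k\<in>S. a k) = a k" by auto
  then show ?thesis using member_le_sum[of k S "\<lambda>k. (a k)\<^sup>2"] assms by auto
qed

lemma mean_power2_le:
  fixes a :: "'k \<Rightarrow> real"
  assumes "finite S" "S \<noteq> {}"
  shows "((\<Sum>i\<in>S. a i) / card S)\<^sup>2 \<le> (\<Sum>i\<in>S. (a i)\<^sup>2) / card S"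
proof -
  have "card S > 0" using assms by (simp add: card_gt_0_iff)
  then show ?thesis using sum_squared_le_sum_of_squares[of a S] assms
    by (simp add: power_divide divide_simps power2_eq_square)
qed

text \<open>The weighted AM-GM inequality. It is linear in x^2, so under an integral it uses second
  moments without any square root of an integral. The factor 2 lets two such terms share one
  \<open>1 / s\<close>.\<close>

lemma abs_le_quadratic: "s > 0 \<Longrightarrow> 2 * \<bar>x\<bar> \<le> s * x\<^sup>2 + 1 / s" for s x :: real
proof -
  assume s: "s > 0"
  have "0 \<le> (s * \<bar>x\<bar> - 1)\<^sup>2 / s" using s by simp
  also have "\<dots> = s * x\<^sup>2 + 1 / s - 2 * \<bar>x\<bar>"
    using s by (simp add: power2_eq_square field_simps)
  finally show ?thesis by simp
qed

lemma abs_le_quadratic': "s > 0 \<Longrightarrow> \<bar>x\<bar> \<le> s * x\<^sup>2 + 1 / s" for s x :: real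
  using abs_le_quadratic[of s x] by (rule order_trans[rotated]) auto

section \<open>Independence and logarithmic potentials\<close>

text \<open>The array is independent as a family indexed by pairs, whereas the law of large numbers
  concerns one column; there \<open>h\<close> maps \<open>i\<close> to
  \<open>(i, k)\<close>.\<close>

lemma (in prob_space) indep_vars_reindex:
  assumes inj: "inj_on h I" and ind: "indep_vars (\<lambda>_. N) Y (h ` I)"
  shows "indep_vars (\<lambda>_. N) (\<lambda>i. Y (h i)) I"
  unfolding indep_vars_def2
proof (intro conjI indep_setsI ballI)
  note ind' = ind[unfolded indep_vars_def2]
  show rv: "random_variable N (Y (h i))" if "i \<in> I" for i using ind' that by auto
  show "{Y (h i) -` A \<inter> space M |A. A \<in> sets N} \<subseteq> events" if "i \<in> I" for i
    using measurable_sets[OF rv[OF that]] by auto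
  fix A J assume J: "J \<noteq> {}" "J \<subseteq> I" "finite J"
    and A: "\<forall>j\<in>J. A j \<in> {Y (h j) -` A \<inter> space M |A. A \<in> sets N}"
  define A' where "A' = A \<circ> inv_into J h"
  have injJ: "inj_on h J" using inj J(2) inj_on_subset by blast
  have A': "A' (h j) = A j" if "j \<in> J" for j
    using inv_into_f_f[OF injJ that] by (simp add: A'_def)
  have "prob (\<Inter>j\<in>h ` J. A' j) = (\<Prod>j\<in>h ` J. prob (A' j))"
    using J A A' by (intro indep_setsD[OF conjunct2[OF ind']]) auto
  then show "prob (\<Inter>j\<in>J. A j) = (\<Prod>j\<in>J. prob (A j))"
    using A' by (simp add: prod.reindex[OF injJ] image_image cong: INF_cong_simp)
qed

text \<open>Independence expressed by generated sigma-algebras lets \<open>F\<close> and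
  \<open>G\<close> take values in different spaces, here the plane and a space of arrays. Rectangles
  determine the product measure, so it is enough to compare those.\<close>

lemma (in prob_space) distr_pair_indep_set:
  assumes [measurable]: "F \<in> measurable M S" "G \<in> measurable M T"
    and ind: "indep_set (sets (vimage_algebra (space M) F S)) (sets (vimage_algebra (space M) G T))"
  shows "distr M S F \<Otimes>\<^sub>M distr M T G = distr M (S \<Otimes>\<^sub>M T) (\<lambda>\<omega>. (F \<omega>, G \<omega>))"
proof -
  interpret F: prob_space "distr M S F" by (rule prob_space_distr) simp
  interpret G: prob_space "distr M T G" by (rule prob_space_distr) simp
  show ?thesis
  proof (rule pair_measure_eqI)
    fix A B assume "A \<in> sets (distr M S F)" "B \<in> sets (distr M T G)"
    then have [measurable]: "A \<in> sets S" "B \<in> sets T" by auto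
    have "prob ((F -` A \<inter> space M) \<inter> (G -` B \<inter> space M)) = prob (F -` A \<inter> space M) * prob (G -` B \<inter> space M)"
      by (rule indep_setD[OF ind]) (auto intro!: in_vimage_algebra)
    then have "emeasure M (F -` A \<inter> space M) * emeasure M (G -` B \<inter> space M) =
        emeasure M ((F -` A \<inter> space M) \<inter> (G -` B \<inter> space M))"
      by (simp add: emeasure_eq_measure ennreal_mult[symmetric])
    also have "(F -` A \<inter> space M) \<inter> (G -` B \<inter> space M) = (\<lambda>\<omega>. (F \<omega>, G \<omega>)) -` (A \<times> B) \<inter> space M"
      by auto
    finally show "emeasure (distr M S F) A * emeasure (distr M T G) B =
        emeasure (distr M (S \<Otimes>\<^sub>M T) (\<lambda>\<omega>. (F \<omega>, G \<omega>))) (A \<times> B)"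
      by (simp add: emeasure_distr)
  qed (simp_all add: F.sigma_finite_measure_axioms G.sigma_finite_measure_axioms cong: sets_pair_measure_cong)
qed

text \<open>The error bound is integrated twice, first over z and then over the sample space, and
  has this linear shape both times. Constants integrate to themselves because the total mass is
  1.\<close>

lemma (in prob_space) nn_integral_affine_sum:
  fixes B F :: "'a \<Rightarrow> ennreal" and G D :: "'i \<Rightarrow> 'a \<Rightarrow> ennreal"
  assumes [measurable]: "B \<in> borel_measurable M" "F \<in> borel_measurable M"
    and GD: "\<And>k. k \<in> S \<Longrightarrow> G k \<in> borel_measurable M" "\<And>k. k \<in> S \<Longrightarrow> D k \<in> borel_measurable M"
  shows "(\<integral>\<^sup>+x. a + b * B x + d * F x + (\<Sum>k\<in>S. e * G k x + (s * D k x + t)) \<partial>M) =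
    a + b * (\<integral>\<^sup>+x. B x \<partial>M) + d * (\<integral>\<^sup>+x. F x \<partial>M)
      + (\<Sum>k\<in>S. e * (\<integral>\<^sup>+x. G k x \<partial>M) + (s * (\<integral>\<^sup>+x. D k x \<partial>M) + t))"
proof -
  have "(\<integral>\<^sup>+x. e * G k x + (s * D k x + t) \<partial>M) = e * (\<integral>\<^sup>+x. G k x \<partial>M) + (s * (\<integral>\<^sup>+x. D k x \<partial>M) + t)"
    if "k \<in> S" for k
  proof -
    note [measurable] = GD[OF that]
    show ?thesis by (simp add: nn_integral_add nn_integral_cmult emeasure_space_1)
  qed
  moreover have GD'[measurable]: "(\<lambda>x. e * G k x + (s * D k x + t)) \<in> borel_measurable M" if "k \<in> S" for k
    using GD[OF that] by measurable
  ultimately show ?thesis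
    by (simp add: nn_integral_add nn_integral_cmult nn_integral_sum emeasure_space_1)
qed

text \<open>The law of large numbers in mean square. As an inequality in \<open>ennreal\<close> it
  also covers an infinite second moment, so it can be applied at every z although finiteness is
  known only for almost every z.\<close>

lemma (in prob_space) mean_square_deviation_le:
  fixes Y :: "'i \<Rightarrow> 'a \<Rightarrow> real"
  assumes I: "finite I" "I \<noteq> {}" and ind: "indep_vars (\<lambda>_. borel) Y I"
    and D: "\<And>i. i \<in> I \<Longrightarrow> distr M borel (Y i) = D"
  shows "(\<integral>\<^sup>+\<omega>. ennreal (((\<Sum>i\<in>I. Y i \<omega>) / card I - (LINT x|D. x))\<^sup>2) \<partial>M)
    \<le> (\<integral>\<^sup>+x. ennreal (x\<^sup>2) \<partial>D) * ennreal (1 / card I)"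
proof -
  define u where "u = (LINT x|D. x)"
  have cI: "card I > 0" using I by (simp add: card_gt_0_iff)
  have rv: "Y i \<in> borel_measurable M" if "i \<in> I" for i using ind that by (auto simp: indep_vars_def)
  have setsD [measurable_cong]: "sets D = sets borel" using I D by (metis all_not_in_conv sets_distr)
  show ?thesis
  proof (cases "(\<integral>\<^sup>+x. ennreal (x\<^sup>2) \<partial>D) < \<infinity>")
    case False
    then show ?thesis using cI by (simp add: not_less top_unique ennreal_top_mult)
  next
    case True
    then have iD: "integrable D (\<lambda>x. x\<^sup>2)" by (intro integrableI_bounded) auto
    have i2: "integrable M (\<lambda>\<omega>. (Y i \<omega>)\<^sup>2)" if "i \<in> I" for i
      using iD unfolding D[OF that, symmetric] using rv[OF that] by (simp add: integrable_distr_eq)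
    have i1: "integrable M (Y i)" if "i \<in> I" for i
      using square_integrable_imp_integrable[OF rv i2] that by simp
    have e1: "expectation (Y i) = u" if "i \<in> I" for i
      unfolding u_def D[OF that, symmetric] using rv[OF that] by (simp add: integral_distr)
    have e2: "expectation (\<lambda>\<omega>. (Y i \<omega>)\<^sup>2) = (LINT x|D. x\<^sup>2)" if "i \<in> I" for i
      unfolding D[OF that, symmetric] using rv[OF that] by (simp add: integral_distr)
    define W where "W i \<omega> = Y i \<omega> - u" for i \<omega>
    have indW: "indep_vars (\<lambda>_. borel) W I"
      unfolding W_def[abs_def] by (rule indep_vars_compose2[OF ind]) auto
    have iW: "integrable M (W i)" "expectation (W i) = 0" if "i \<in> I" for i
      unfolding W_def[abs_def] using i1[OF that] e1[OF that] by (auto simp: prob_space)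
    \<comment> \<open>Diagonal expectations are variances, at most the second moment; independence
      and centring make all others vanish. Only \<open>card I\<close> of the
      \<open>(card I)^2\<close> products contribute, which yields the rate.\<close>
    have WW: "integrable M (\<lambda>\<omega>. W i \<omega> * W j \<omega>) \<and> expectation (\<lambda>\<omega>. W i \<omega> * W j \<omega>) \<le> (if i = j then LINT x|D. x\<^sup>2 else 0)"
      if ij: "i \<in> I" "j \<in> I" for i j
    proof (cases "i = j")
      case True
      have eq: "W i \<omega> * W j \<omega> = (Y i \<omega>)\<^sup>2 - 2 * u * Y i \<omega> + u\<^sup>2" for \<omega>
        using True by (simp add: W_def power2_eq_square algebra_simps)
      show ?thesis unfolding eq using i1 i2 e1 e2 ij True by (simp add: prob_space power2_eq_square)
    next
      case False
      have "indep_vars (\<lambda>_. borel) W {i, j}" by (rule indep_vars_subset[OF indW]) (use ij in auto)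
      moreover have "integrable M (W k)" if "k \<in> {i, j}" for k using that ij iW by auto
      ultimately show ?thesis
        using False ij iW indep_vars_lebesgue_integral[of "{i, j}" W] indep_vars_integrable[of "{i, j}" W] by simp
    qed
    let ?S = "\<lambda>\<omega>. (\<Sum>i\<in>I. \<Sum>j\<in>I. W i \<omega> * W j \<omega>) / (card I)\<^sup>2"
    have eq: "((\<Sum>i\<in>I. Y i \<omega>) / card I - u)\<^sup>2 = ?S \<omega>" for \<omega>
    proof -
      have "(\<Sum>i\<in>I. Y i \<omega>) / card I - u = (\<Sum>i\<in>I. W i \<omega>) / card I"
        using cI by (simp add: W_def sum_subtractf field_simps)
      then show ?thesis by (simp add: power_divide power2_eq_square sum_product)
    qed
    have intS: "integrable M ?S"
      using WW by (intro integrable_divide Bochner_Integration.integrable_sum) blast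
    have "expectation ?S = (\<Sum>i\<in>I. \<Sum>j\<in>I. expectation (\<lambda>\<omega>. W i \<omega> * W j \<omega>)) / (card I)\<^sup>2"
      using WW by (simp add: Bochner_Integration.integral_sum)
    also have "\<dots> \<le> (\<Sum>i\<in>I. \<Sum>j\<in>I. if i = j then LINT x|D. x\<^sup>2 else 0) / (card I)\<^sup>2"
      using WW by (intro divide_right_mono sum_mono) auto
    also have "\<dots> = (LINT x|D. x\<^sup>2) * (1 / card I)"
      using I cI by (simp add: power2_eq_square)
    finally have "expectation ?S \<le> (LINT x|D. x\<^sup>2) * (1 / card I)" .
    moreover have "(\<integral>\<^sup>+\<omega>. ennreal (?S \<omega>) \<partial>M) = ennreal (expectation ?S)"
      by (rule nn_integral_eq_integral[OF intS], rule AE_I2) (metis eq zero_le_power2)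
    moreover have "(\<integral>\<^sup>+x. ennreal (x\<^sup>2) \<partial>D) = ennreal (LINT x|D. x\<^sup>2)"
      by (rule nn_integral_eq_integral[OF iD]) simp
    ultimately show ?thesis unfolding u_def[symmetric] eq
      by (simp only: ennreal_mult[symmetric] integral_nonneg_AE zero_le_power2 AE_I2 ennreal_leI zero_le_divide_1_iff of_nat_0_le_iff)
  qed
qed

text \<open>The complement of the support is the union of all open null sets. By Lindelof countably
  many of them cover it.\<close>

lemma emeasure_outside_msupport:
  fixes \<mu> :: "'a::second_countable_topology measure"
  assumes s: "sets \<mu> = sets borel"
  shows "emeasure \<mu> (- msupport \<mu>) = 0"
proof -
  let ?F = "{V. open V \<and> emeasure \<mu> V = 0}"
  obtain F where F: "F \<subseteq> ?F" "countable F" "\<Union>F = \<Union>?F"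
    by (rule Lindelof[of ?F]) auto
  have "- msupport \<mu> = \<Union>?F" by (auto simp: msupport_def)
  also have "\<dots> = \<Union>F" using F by simp
  also have "emeasure \<mu> \<dots> = 0"
  proof -
    have "(\<Union>V\<in>F. V) \<in> null_sets \<mu>"
      using F s by (intro null_sets_UN') (auto simp: null_sets_def)
    then show ?thesis by auto
  qed
  finally show ?thesis .
qed

lemma compact_prob_measure_bounded:
  assumes "\<mu> \<in> compact_prob_measures"
  obtains R where "AE w in \<mu>. cmod w \<le> R"
proof -
  have s: "sets \<mu> = sets borel" and c: "compact (msupport \<mu>)"
    using assms by (auto simp: compact_prob_measures_def)
  obtain R where R: "\<And>w. w \<in> msupport \<mu> \<Longrightarrow> cmod w \<le> R"
    using compact_imp_bounded[OF c] by (auto simp: bounded_iff)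
  have "AE w in \<mu>. w \<notin> - msupport \<mu>"
    using c by (intro AE_not_in) (auto simp: null_sets_def emeasure_outside_msupport[OF s] s compact_imp_closed)
  then have "AE w in \<mu>. cmod w \<le> R" by eventually_elim (use R in auto)
  then show ?thesis by (rule that)
qed

text \<open>Integrability rules out a difference of two infinities. As z is not an atom, the values
  -\<infinity> of \<open>ext_ln 0\<close> and 0 of \<open>ln 0\<close> are met on a null
  set.\<close>

lemma log_potential_eq_integral:
  assumes i: "integrable \<mu> (\<lambda>w. ln (cmod (z - w)))" and ae: "AE w in \<mu>. z \<noteq> w"
  shows "log_potential \<mu> z = ereal (LINT w|\<mu>. ln (cmod (z - w)))"
proof -
  have 1: "(\<integral>\<^sup>+w. e2ennreal (ext_ln (cmod (z - w))) \<partial>\<mu>) = (\<integral>\<^sup>+w. ennreal (ln (cmod (z - w))) \<partial>\<mu>)"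
    by (rule nn_integral_cong_AE) (use ae in eventually_elim, simp add: ext_ln_def)
  have 2: "(\<integral>\<^sup>+w. e2ennreal (- ext_ln (cmod (z - w))) \<partial>\<mu>) = (\<integral>\<^sup>+w. ennreal (- ln (cmod (z - w))) \<partial>\<mu>)"
    by (rule nn_integral_cong_AE) (use ae in eventually_elim, simp add: ext_ln_def)
  have f: "(\<integral>\<^sup>+w. ennreal (ln (cmod (z - w))) \<partial>\<mu>) < \<infinity>" "(\<integral>\<^sup>+w. ennreal (- ln (cmod (z - w))) \<partial>\<mu>) < \<infinity>"
    using i by (auto simp: real_integrable_def less_top)
  have e: "enn2ereal x = ereal (enn2real x)" if "x < \<infinity>" for x
    using that by (cases x) (auto simp: enn2ereal_ennreal)
  show ?thesis unfolding log_potential_def 1 2 e[OF f(1)] e[OF f(2)] real_lebesgue_integral_def[OF i] by simp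
qed

section \<open>The random setting\<close>

text \<open>\<open>R\<close> is one radius for the support of \<phi> and for all the measures. With
  \<open>R >= 1\<close>, twice a radius of at least \<open>R\<close> is an admissible
  \<open>T\<close> in \<open>nn_integral_ln_square_le\<close>.\<close>

locale random_polynomial_sum = prob_space M for M :: "'a measure" +
  fixes m :: nat and \<mu> :: "nat \<Rightarrow> complex measure" and X :: "nat \<Rightarrow> nat \<Rightarrow> 'a \<Rightarrow> complex"
    and Z :: "'a \<Rightarrow> complex" and \<phi> :: "complex \<Rightarrow> complex" and R :: real
  assumes m: "m \<ge> 1"
    and indep: "indep_vars (\<lambda>_. borel) (\<lambda>(i, k). X i k) ({1..} \<times> {1..m})"
    and distr_X: "\<And>i k. i \<ge> 1 \<Longrightarrow> k \<in> {1..m} \<Longrightarrow> distr M borel (X i k) = \<mu> k"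
    and \<phi>: "smooth \<phi>" "compact (fsupport \<phi>)"
    and Z[measurable]: "Z \<in> borel_measurable M"
    and distr_Z: "distr M borel Z = uniform_measure lborel (fsupport \<phi>)"
    and indep_Z: "indep_set
           (sets (vimage_algebra (space M) Z borel))
           (sets (vimage_algebra (space M) (\<lambda>\<omega>. \<lambda>(i, k)\<in>{1..} \<times> {1..m}. X i k \<omega>)
              (Pi\<^sub>M ({1..} \<times> {1..m}) (\<lambda>_. borel))))"
    and R: "R \<ge> 1" "\<And>z. z \<in> fsupport \<phi> \<Longrightarrow> cmod z \<le> R"
      "\<And>k. k \<in> {1..m} \<Longrightarrow> AE w in \<mu> k. cmod w \<le> R"
begin

abbreviation "K \<equiv> fsupport \<phi>"

text \<open>The law of \<open>Z\<close>, kept as a separate factor so that z can be integrated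
  independently of the sample point.\<close>

definition \<nu> :: "complex measure" where "\<nu> = uniform_measure lborel K"

definition c :: real where "c = enn2real (ln_disc_const / emeasure lborel K)"

definition q :: "nat \<Rightarrow> nat \<Rightarrow> 'a \<Rightarrow> complex \<Rightarrow> complex" where
  "q n k \<omega> z = (\<Prod>i=1..n. z - X i k \<omega>)"

text \<open>Subtracting \<open>ln m\<close> removes the leading coefficient, so that
  \<open>f\<close> is exactly the mean of \<open>ln |z - r|\<close> over the zeros r of the
  sum.\<close>

definition f :: "nat \<Rightarrow> 'a \<Rightarrow> complex \<Rightarrow> real" where
  "f n \<omega> z = (ln (cmod (\<Sum>k=1..m. q n k \<omega> z)) - ln m) / n"

text \<open>Away from the zeros this is \<open>ln (cmod (q n k \<omega> z)) / n\<close>. Written as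
  a mean of logarithms it is an average of independent variables at every z, in spite of
  \<open>ln 0 = 0\<close>.\<close>

definition g :: "nat \<Rightarrow> nat \<Rightarrow> 'a \<Rightarrow> complex \<Rightarrow> real" where
  "g n k \<omega> z = (\<Sum>i=1..n. ln (cmod (z - X i k \<omega>))) / n"

definition U :: "nat \<Rightarrow> complex \<Rightarrow> real" where
  "U k z = (LINT w|\<mu> k. ln (cmod (z - w)))"

definition V :: "complex \<Rightarrow> real" where
  "V z = (MAX k\<in>{1..m}. U k z)"

text \<open>Where a denominator vanishes the quotient is 0 and the pair counts as separated; by
  \<open>AE_q_nonzero\<close> such z form a null set.\<close>

definition bad :: "nat \<Rightarrow> 'a \<Rightarrow> complex \<Rightarrow> bool" where
  "bad n \<omega> z \<longleftrightarrow> (\<exists>k\<in>{1..m}. \<exists>l\<in>{1..m} - {k}.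
     1 / 2 \<le> cmod (q n k \<omega> z / q n l \<omega> z) \<and> cmod (q n k \<omega> z / q n l \<omega> z) \<le> 2)"

lemma poly_sum_rand_poly: "poly (\<Sum>k=1..m. rand_poly X n k \<omega>) z = (\<Sum>k=1..m. q n k \<omega> z)"
  by (simp add: poly_sum poly_rand_poly q_def)

lemma X_measurable [measurable]: "i \<ge> 1 \<Longrightarrow> k \<in> {1..m} \<Longrightarrow> X i k \<in> borel_measurable M"
  using indep unfolding indep_vars_def by fastforce

lemma sets_\<mu>: "k \<in> {1..m} \<Longrightarrow> sets (\<mu> k) = sets borel"
  using distr_X[of 1 k] by (metis order_refl sets_distr)

lemma prob_space_\<mu>: "k \<in> {1..m} \<Longrightarrow> prob_space (\<mu> k)"
  using distr_X[of 1 k] prob_space_distr[OF X_measurable[of 1 k]] by simp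

lemma sets_\<nu> [simp, measurable_cong]: "sets \<nu> = sets borel"
  by (simp add: \<nu>_def)

lemma space_\<nu> [simp]: "space \<nu> = UNIV"
  by (simp add: \<nu>_def)

lemma prob_space_\<nu>: "prob_space \<nu>"
  unfolding \<nu>_def distr_Z[symmetric] by (rule prob_space_distr) simp

lemma K_measurable [measurable]: "K \<in> sets borel"
  using \<phi>(2) by (simp add: compact_imp_closed)

text \<open>Positivity is read off from the law of \<open>Z\<close>: normalising by a null set would
  give total mass 0 instead of 1.\<close>

lemma emeasure_K: "emeasure lborel K \<noteq> 0" "emeasure lborel K < \<infinity>"
proof -
  show "emeasure lborel K < \<infinity>" using \<phi>(2) by (rule emeasure_compact_finite)
  have "emeasure \<nu> UNIV = 1" using prob_space.emeasure_space_1[OF prob_space_\<nu>] by simp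
  then show "emeasure lborel K \<noteq> 0" by (auto simp: \<nu>_def)
qed

section \<open>Second moments of logarithms over the support\<close>

lemma nn_integral_\<nu>:
  assumes "h \<in> borel_measurable borel"
  shows "(\<integral>\<^sup>+z. h z \<partial>\<nu>) = (\<integral>\<^sup>+z. h z * indicator K z \<partial>lborel) / emeasure lborel K"
  unfolding \<nu>_def using assms by (intro nn_integral_uniform_measure) auto

lemma nn_integral_lborel_K:
  assumes "h \<in> borel_measurable borel"
  shows "(\<integral>\<^sup>+z. h z * indicator K z \<partial>lborel) = emeasure lborel K * (\<integral>\<^sup>+z. h z \<partial>\<nu>)"
  unfolding nn_integral_\<nu>[OF assms] using emeasure_K
  by (metis ennreal_mult_divide_eq ennreal_times_divide infinity_ennreal_def less_irrefl mult.commute)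

lemma AE_\<nu>I: "AE z in lborel. P z \<Longrightarrow> AE z in \<nu>. P z"
  unfolding \<nu>_def by (rule AE_uniform_measureI) (auto elim: eventually_mono)

lemma c_eq: "ln_disc_const / emeasure lborel K = ennreal c"
proof -
  have "ln_disc_const \<noteq> \<top>" using nn_integral_ln_square_disc by (auto simp: ln_disc_const_def)
  then have "ln_disc_const / emeasure lborel K \<noteq> \<top>"
    using emeasure_K by (simp add: ennreal_divide_eq_top_iff)
  then show ?thesis by (simp add: c_def less_top)
qed

lemma c_nonneg: "c \<ge> 0" by (simp add: c_def)

text \<open>Both z and w lie in the disc of radius \<open>S\<close>, hence the 2. It is applied with
  \<open>S = R\<close> to the random points and with \<open>S = 2 * n * R\<close> to the zeros of
  the sum.\<close>

lemma nn_integral_\<nu>_ln_square: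
  assumes "cmod w \<le> S" "S \<ge> R"
  shows "(\<integral>\<^sup>+z. ennreal ((ln (cmod (z - w)))\<^sup>2) \<partial>\<nu>) \<le> ennreal (c + (ln (2 * S))\<^sup>2)"
proof -
  have T: "2 * S \<ge> 1" "cmod (z - w) \<le> 2 * S" if "z \<in> K" for z
    using R(1) R(2)[OF that] assms norm_triangle_ineq4[of z w] by linarith+
  have "(\<integral>\<^sup>+z. ennreal ((ln (cmod (z - w)))\<^sup>2) \<partial>\<nu>) \<le>
     (ln_disc_const + ennreal ((ln (2 * S))\<^sup>2) * emeasure lborel K) / emeasure lborel K"
    using R(1) assms T by (subst nn_integral_\<nu>) (auto intro!: divide_right_mono_ennreal nn_integral_ln_square_le)
  also have "\<dots> = ennreal c + ennreal ((ln (2 * S))\<^sup>2)"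
    using emeasure_K by (simp add: add_divide_distrib_ennreal c_eq ennreal_mult_divide_eq less_top)
  also have "\<dots> = ennreal (c + (ln (2 * S))\<^sup>2)" using c_nonneg by simp
  finally show ?thesis .
qed

lemma AE_X_bounded: "AE \<omega> in M. \<forall>k\<in>{1..m}. \<forall>i\<in>{1..n}. cmod (X i k \<omega>) \<le> R"
proof -
  have "AE \<omega> in M. cmod (X i k \<omega>) \<le> R" if "i \<in> {1..n}" "k \<in> {1..m}" for i k
  proof -
    have "AE w in distr M borel (X i k). cmod w \<le> R" using that R(3) by (subst distr_X) auto
    then show ?thesis using that by (subst (asm) AE_distr_iff) auto
  qed
  then show ?thesis by (intro AE_finite_allI) auto
qed

text \<open>Convexity of the square: a bound common to all summands passes to their mean, with no
  loss in the number of summands and no condition on how the singularities are placed.\<close>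

lemma nn_integral_mean_power2_le:
  fixes h :: "nat \<Rightarrow> complex \<Rightarrow> real"
  assumes S: "finite S" "S \<noteq> {}" and h[measurable]: "\<And>i. i \<in> S \<Longrightarrow> h i \<in> borel_measurable borel"
    and le: "\<And>i. i \<in> S \<Longrightarrow> (\<integral>\<^sup>+z. ennreal ((h i z)\<^sup>2) \<partial>\<nu>) \<le> ennreal B"
  shows "(\<integral>\<^sup>+z. ennreal (((\<Sum>i\<in>S. h i z) / card S)\<^sup>2) \<partial>\<nu>) \<le> ennreal B"
proof -
  have cS: "card S > 0" using S by (simp add: card_gt_0_iff)
  have "(\<integral>\<^sup>+z. ennreal (((\<Sum>i\<in>S. h i z) / card S)\<^sup>2) \<partial>\<nu>) \<le>
     (\<integral>\<^sup>+z. ennreal (1 / card S) * (\<Sum>i\<in>S. ennreal ((h i z)\<^sup>2)) \<partial>\<nu>)"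
    using mean_power2_le[OF S] by (intro nn_integral_mono) (auto simp: ennreal_mult[symmetric] sum_nonneg intro!: ennreal_leI)
  also have "\<dots> = ennreal (1 / card S) * (\<Sum>i\<in>S. (\<integral>\<^sup>+z. ennreal ((h i z)\<^sup>2) \<partial>\<nu>))"
    by (subst nn_integral_cmult) (simp_all add: nn_integral_sum del: sum_ennreal)
  also have "\<dots> \<le> ennreal (1 / card S) * (\<Sum>i\<in>S. ennreal B)"
    using le by (intro mult_left_mono sum_mono) auto
  also have "\<dots> = ennreal B"
    using cS by (simp add: mult.assoc[symmetric] ennreal_of_nat_eq_real_of_nat ennreal_mult[symmetric])
  finally show ?thesis .
qed

text \<open>The zeros themselves are excluded in the last clause because \<open>ln 0 = 0\<close>
  does not turn a vanishing product into the sum of logarithms.\<close>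

lemma f_roots:
  obtains r :: "nat \<Rightarrow> complex" where
    "\<And>i. i < n \<Longrightarrow> poly (\<Sum>k=1..m. rand_poly X n k \<omega>) (r i) = 0"
    "\<And>h :: complex \<Rightarrow> complex. (\<Sum>z\<in>#proots (\<Sum>k=1..m. rand_poly X n k \<omega>). h z) = (\<Sum>i<n. h (r i))"
    "\<And>z. z \<notin> r ` {..<n} \<Longrightarrow> f n \<omega> z = (\<Sum>i<n. ln (cmod (z - r i))) / n"
proof -
  obtain r where r: "\<And>z. poly (\<Sum>k=1..m. rand_poly X n k \<omega>) z = of_nat m * (\<Prod>i<n. z - r i)"
    "\<And>h :: complex \<Rightarrow> complex. (\<Sum>z\<in>#proots (\<Sum>k=1..m. rand_poly X n k \<omega>). h z) = (\<Sum>i<n. h (r i))"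
    using sum_rand_poly_roots[OF m, of X n \<omega>] by blast
  have "f n \<omega> z = (\<Sum>i<n. ln (cmod (z - r i))) / n" if "z \<notin> r ` {..<n}" for z
  proof -
    have nz: "cmod (z - r i) \<noteq> 0" if "i \<in> {..<n}" for i using \<open>z \<notin> r ` {..<n}\<close> that by auto
    have "ln (\<Prod>i<n. cmod (z - r i)) = (\<Sum>i<n. ln (cmod (z - r i)))"
      by (rule ln_prod) (use nz in auto)
    moreover have "(\<Prod>i<n. cmod (z - r i)) \<noteq> 0" using nz by (simp add: prod_zero_iff)
    ultimately have "ln (cmod (of_nat m * (\<Prod>i<n. z - r i))) = ln m + (\<Sum>i<n. ln (cmod (z - r i)))"
      using m by (simp add: norm_mult prod_norm[symmetric] ln_mult)
    then show ?thesis unfolding f_def poly_sum_rand_poly[symmetric] r by simp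
  qed
  moreover have "poly (\<Sum>k=1..m. rand_poly X n k \<omega>) (r i) = 0" if "i < n" for i
    unfolding r using that by auto
  ultimately show ?thesis using that[of r] r(2) by blast
qed

text \<open>The zeros of the sum may escape to infinity, but only linearly in \<open>n\<close>; this is where the logarithm
  of \<open>n\<close> enters.\<close>

lemma nn_integral_f_square:
  assumes n: "n \<ge> 1" and \<omega>: "\<forall>k\<in>{1..m}. \<forall>i\<in>{1..n}. cmod (X i k \<omega>) \<le> R"
  shows "(\<integral>\<^sup>+z. ennreal ((f n \<omega> z)\<^sup>2) \<partial>\<nu>) \<le> ennreal (c + (ln (4 * n * R))\<^sup>2)"
proof -
  obtain r where r: "\<And>i. i < n \<Longrightarrow> poly (\<Sum>k=1..m. rand_poly X n k \<omega>) (r i) = 0"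
    "\<And>z. z \<notin> r ` {..<n} \<Longrightarrow> f n \<omega> z = (\<Sum>i<n. ln (cmod (z - r i))) / n"
    using f_roots[of n \<omega>] by metis
  have rb: "cmod (r i) \<le> 2 * real n * R" if "i < n" for i
    using \<omega> R(1) by (intro sum_rand_poly_root_bound[OF m n, where X=X and \<omega>=\<omega>] r(1)[OF that]) auto
  have nR: "2 * real n * R \<ge> R" using n R by simp
  have fr: "f n \<omega> z = (\<Sum>i<n. ln (cmod (z - r i))) / card {..<n}" if "z \<notin> r ` {..<n}" for z
    using r(2)[OF that] by simp
  have "(\<integral>\<^sup>+z. ennreal ((f n \<omega> z)\<^sup>2) \<partial>\<nu>) = (\<integral>\<^sup>+z. ennreal (((\<Sum>i<n. ln (cmod (z - r i))) / card {..<n})\<^sup>2) \<partial>\<nu>)"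
  proof (rule nn_integral_cong_AE)
    have "AE z in \<nu>. z \<notin> r ` {..<n}"
      by (intro AE_\<nu>I AE_not_in finite_imp_null_set_lborel) auto
    then show "AE z in \<nu>. ennreal ((f n \<omega> z)\<^sup>2) = ennreal (((\<Sum>i<n. ln (cmod (z - r i))) / card {..<n})\<^sup>2)"
    proof eventually_elim
      case (elim z)
      show ?case by (simp only: fr[OF elim])
    qed
  qed
  also have "\<dots> \<le> ennreal (c + (ln (2 * (2 * real n * R)))\<^sup>2)"
    using n rb nR by (intro nn_integral_mean_power2_le nn_integral_\<nu>_ln_square) (auto simp: lessThan_empty_iff)
  finally show ?thesis by (simp add: mult.assoc)
qed

lemma nn_integral_g_square:
  assumes n: "n \<ge> 1" and k: "k \<in> {1..m}" and \<omega>: "\<forall>k\<in>{1..m}. \<forall>i\<in>{1..n}. cmod (X i k \<omega>) \<le> R"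
  shows "(\<integral>\<^sup>+z. ennreal ((g n k \<omega> z)\<^sup>2) \<partial>\<nu>) \<le> ennreal (c + (ln (2 * R))\<^sup>2)"
proof -
  have "(\<integral>\<^sup>+z. ennreal (((\<Sum>i\<in>{1..n}. ln (cmod (z - X i k \<omega>))) / card {1..n})\<^sup>2) \<partial>\<nu>) \<le> ennreal (c + (ln (2 * R))\<^sup>2)"
    using n k \<omega> by (intro nn_integral_mean_power2_le nn_integral_\<nu>_ln_square) auto
  then show ?thesis by (simp add: g_def)
qed

lemma measurable_U [measurable]: "k \<in> {1..m} \<Longrightarrow> U k \<in> borel_measurable borel"
proof -
  assume k: "k \<in> {1..m}"
  interpret \<mu>: prob_space "\<mu> k" using k by (rule prob_space_\<mu>)
  have [measurable_cong]: "sets (\<mu> k) = sets borel" using k by (rule sets_\<mu>)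
  show ?thesis unfolding U_def[abs_def] by measurable
qed

lemma measurable_V [measurable]: "V \<in> borel_measurable borel"
  unfolding V_def[abs_def] using m by (intro borel_measurable_Max) auto

text \<open>Tonelli moves the integral over z inside, where it is bounded uniformly in w. For an
  individual z nothing bounds the integral over \<open>\<mu> k\<close>.\<close>

lemma nn_integral_\<nu>_\<mu>_ln_square:
  assumes k: "k \<in> {1..m}"
  shows "(\<integral>\<^sup>+z. \<integral>\<^sup>+w. ennreal ((ln (cmod (z - w)))\<^sup>2) \<partial>\<mu> k \<partial>\<nu>) \<le> ennreal (c + (ln (2 * R))\<^sup>2)"
proof -
  interpret \<mu>: prob_space "\<mu> k" using k by (rule prob_space_\<mu>)
  interpret \<nu>: prob_space \<nu> by (rule prob_space_\<nu>)
  interpret pair_sigma_finite "\<mu> k" \<nu> ..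
  have [measurable_cong]: "sets (\<mu> k) = sets borel" using k by (rule sets_\<mu>)
  have "(\<integral>\<^sup>+z. \<integral>\<^sup>+w. ennreal ((ln (cmod (z - w)))\<^sup>2) \<partial>\<mu> k \<partial>\<nu>) = (\<integral>\<^sup>+w. \<integral>\<^sup>+z. ennreal ((ln (cmod (z - w)))\<^sup>2) \<partial>\<nu> \<partial>\<mu> k)"
    by (rule Fubini') measurable
  also have "\<dots> \<le> (\<integral>\<^sup>+w. ennreal (c + (ln (2 * R))\<^sup>2) \<partial>\<mu> k)"
    using R(3)[OF k] by (intro nn_integral_mono_AE) (auto elim!: eventually_mono intro!: nn_integral_\<nu>_ln_square)
  also have "\<dots> = ennreal (c + (ln (2 * R))\<^sup>2)" by (simp add: \<mu>.emeasure_space_1)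
  finally show ?thesis .
qed

lemma AE_ln_square_finite:
  assumes k: "k \<in> {1..m}"
  shows "AE z in \<nu>. (\<integral>\<^sup>+w. ennreal ((ln (cmod (z - w)))\<^sup>2) \<partial>\<mu> k) < \<infinity>"
proof -
  interpret \<mu>: prob_space "\<mu> k" using k by (rule prob_space_\<mu>)
  have [measurable_cong]: "sets (\<mu> k) = sets borel" using k by (rule sets_\<mu>)
  have "(\<integral>\<^sup>+z. \<integral>\<^sup>+w. ennreal ((ln (cmod (z - w)))\<^sup>2) \<partial>\<mu> k \<partial>\<nu>) \<noteq> \<infinity>"
    using nn_integral_\<nu>_\<mu>_ln_square[OF k] by (auto simp: top_unique)
  then have "AE z in \<nu>. (\<integral>\<^sup>+w. ennreal ((ln (cmod (z - w)))\<^sup>2) \<partial>\<mu> k) \<noteq> \<infinity>"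
    by (intro nn_integral_noteq_infinite) measurable
  then show ?thesis by (simp add: less_top)
qed

lemma integrable_ln:
  assumes k: "k \<in> {1..m}" and fin: "(\<integral>\<^sup>+w. ennreal ((ln (cmod (z - w)))\<^sup>2) \<partial>\<mu> k) < \<infinity>"
  shows "integrable (\<mu> k) (\<lambda>w. (ln (cmod (z - w)))\<^sup>2)" "integrable (\<mu> k) (\<lambda>w. ln (cmod (z - w)))"
proof -
  interpret \<mu>: prob_space "\<mu> k" using k by (rule prob_space_\<mu>)
  have [measurable_cong]: "sets (\<mu> k) = sets borel" using k by (rule sets_\<mu>)
  show i2: "integrable (\<mu> k) (\<lambda>w. (ln (cmod (z - w)))\<^sup>2)"
  proof (rule integrableI_nonneg[OF _ _ fin])
    show "(\<lambda>w. (ln (cmod (z - w)))\<^sup>2) \<in> borel_measurable (\<mu> k)" by measurable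
  qed simp
  show "integrable (\<mu> k) (\<lambda>w. ln (cmod (z - w)))"
    by (rule \<mu>.square_integrable_imp_integrable[OF _ i2]) measurable
qed

text \<open>Nonnegativity of the variance; at points with an infinite second moment the right-hand
  side is infinite.\<close>

lemma U_power2_le:
  assumes k: "k \<in> {1..m}"
  shows "ennreal ((U k z)\<^sup>2) \<le> (\<integral>\<^sup>+w. ennreal ((ln (cmod (z - w)))\<^sup>2) \<partial>\<mu> k)"
proof (cases "(\<integral>\<^sup>+w. ennreal ((ln (cmod (z - w)))\<^sup>2) \<partial>\<mu> k) < \<infinity>")
  case False
  then show ?thesis by (simp add: not_less top_unique)
next
  case True
  interpret \<mu>: prob_space "\<mu> k" using k by (rule prob_space_\<mu>)
  note i2 = integrable_ln(1)[OF k True] and i1 = integrable_ln(2)[OF k True]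
  have "0 \<le> \<mu>.variance (\<lambda>w. ln (cmod (z - w)))" by (rule integral_nonneg_AE) simp
  then have "(U k z)\<^sup>2 \<le> (LINT w|\<mu> k. (ln (cmod (z - w)))\<^sup>2)"
    using \<mu>.variance_eq[OF i1 i2] by (simp add: U_def)
  then show ?thesis using nn_integral_eq_integral[OF i2] by (simp add: ennreal_leI)
qed

text \<open>As \<open>ln 0 = 0\<close>, the function \<open>U k\<close> differs from the logarithmic potential at the atoms of \<open>\<mu> k\<close>.\<close>

lemma AE_log_potential:
  assumes k: "k \<in> {1..m}"
  shows "AE z in \<nu>. log_potential (\<mu> k) z = ereal (U k z)"
proof -
  interpret \<mu>: prob_space "\<mu> k" using k by (rule prob_space_\<mu>)
  interpret \<nu>: prob_space \<nu> by (rule prob_space_\<nu>)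
  interpret pair_sigma_finite "\<mu> k" \<nu> ..
  have [measurable_cong]: "sets (\<mu> k) = sets borel" using k by (rule sets_\<mu>)
  \<comment> \<open>A single point is Lebesgue null. Exchanging the quantifiers by Fubini shows that
    almost no z is an atom of \<open>\<mu> k\<close>.\<close>
  have "AE w in \<mu> k. AE z in \<nu>. z \<noteq> w" by (intro AE_I2 AE_\<nu>I AE_lborel_singleton)
  moreover have "{p \<in> space (\<mu> k \<Otimes>\<^sub>M \<nu>). snd p \<noteq> fst p} \<in> sets (\<mu> k \<Otimes>\<^sub>M \<nu>)" by measurable
  ultimately have "AE z in \<nu>. AE w in \<mu> k. z \<noteq> w"
    using AE_commute[of "\<lambda>w z. z \<noteq> w"] by blast
  with AE_ln_square_finite[OF k] show ?thesis
  proof eventually_elim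
    case (elim z)
    have "integrable (\<mu> k) (\<lambda>w. ln (cmod (z - w)))" using elim(1) by (rule integrable_ln(2)[OF k])
    then show ?case unfolding U_def using elim(2) by (rule log_potential_eq_integral)
  qed
qed

lemma AE_V: "AE z in \<nu>. real_of_ereal (MAX k\<in>{1..m}. log_potential (\<mu> k) z) = V z"
proof -
  have "AE z in \<nu>. \<forall>k\<in>{1..m}. log_potential (\<mu> k) z = ereal (U k z)"
    by (intro AE_finite_allI AE_log_potential) auto
  then show ?thesis
  proof eventually_elim
    case (elim z)
    have "(\<lambda>k. log_potential (\<mu> k) z) ` {1..m} = ereal ` (\<lambda>k. U k z) ` {1..m}"
      unfolding image_image using elim by (intro image_cong) auto
    then have "(MAX k\<in>{1..m}. log_potential (\<mu> k) z) = Max (ereal ` (\<lambda>k. U k z) ` {1..m})"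
      by (rule arg_cong)
    also have "\<dots> = ereal (V z)"
      unfolding V_def using m by (intro mono_Max_commute[symmetric]) (auto simp: mono_def)
    finally show ?case by simp
  qed
qed

lemma nn_integral_V_square: "(\<integral>\<^sup>+z. ennreal ((V z)\<^sup>2) \<partial>\<nu>) < \<infinity>"
proof -
  have "(\<integral>\<^sup>+z. ennreal ((V z)\<^sup>2) \<partial>\<nu>) \<le> (\<integral>\<^sup>+z. (\<Sum>k=1..m. \<integral>\<^sup>+w. ennreal ((ln (cmod (z - w)))\<^sup>2) \<partial>\<mu> k) \<partial>\<nu>)"
  proof (rule nn_integral_mono)
    fix z
    have "ennreal ((V z)\<^sup>2) \<le> ennreal (\<Sum>k=1..m. (U k z)\<^sup>2)"
      unfolding V_def using m by (intro ennreal_leI Max_power2_le_sum) auto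
    also have "\<dots> = (\<Sum>k=1..m. ennreal ((U k z)\<^sup>2))" by simp
    also have "\<dots> \<le> (\<Sum>k=1..m. \<integral>\<^sup>+w. ennreal ((ln (cmod (z - w)))\<^sup>2) \<partial>\<mu> k)"
      by (intro sum_mono U_power2_le) auto
    finally show "ennreal ((V z)\<^sup>2) \<le> (\<Sum>k=1..m. \<integral>\<^sup>+w. ennreal ((ln (cmod (z - w)))\<^sup>2) \<partial>\<mu> k)" .
  qed
  also have "\<dots> = (\<Sum>k=1..m. \<integral>\<^sup>+z. \<integral>\<^sup>+w. ennreal ((ln (cmod (z - w)))\<^sup>2) \<partial>\<mu> k \<partial>\<nu>)"
  proof (rule nn_integral_sum)
    fix k assume k: "k \<in> {1..m}"
    interpret \<mu>: prob_space "\<mu> k" using k by (rule prob_space_\<mu>)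
    have [measurable_cong]: "sets (\<mu> k) = sets borel" using k by (rule sets_\<mu>)
    show "(\<lambda>z. \<integral>\<^sup>+w. ennreal ((ln (cmod (z - w)))\<^sup>2) \<partial>\<mu> k) \<in> borel_measurable \<nu>" by measurable
  qed
  also have "\<dots> < \<infinity>"
  proof -
    have "(\<integral>\<^sup>+z. \<integral>\<^sup>+w. ennreal ((ln (cmod (z - w)))\<^sup>2) \<partial>\<mu> k \<partial>\<nu>) < \<top>" if "k \<in> {1..m}" for k
      using nn_integral_\<nu>_\<mu>_ln_square[OF that] by (rule le_less_trans) simp
    then show ?thesis by simp
  qed
  finally show ?thesis .
qed

section \<open>Joint measurability in the sample point and z\<close>

lemma q_measurable [measurable (raw)]:
  assumes "k \<in> {1..m}" "F \<in> measurable N M" "G \<in> borel_measurable N"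
  shows "(\<lambda>x. q n k (F x) (G x)) \<in> borel_measurable N"
  unfolding q_def using assms
  by (intro borel_measurable_prod borel_measurable_diff measurable_compose[OF assms(2) X_measurable]) auto

text \<open>Arbitrary measurable \<open>F\<close> and \<open>G\<close> cover both the product space,
  with the two projections, and the sections at a fixed sample point, with \<open>F\<close>
  constant.\<close>

lemma f_measurable [measurable (raw)]:
  assumes "F \<in> measurable N M" "G \<in> borel_measurable N"
  shows "(\<lambda>x. f n (F x) (G x)) \<in> borel_measurable N"
proof -
  have "(\<lambda>x. \<Sum>k=1..m. q n k (F x) (G x)) \<in> borel_measurable N"
    using assms by (intro borel_measurable_sum q_measurable) auto
  then show ?thesis unfolding f_def by measurable
qed

lemma g_measurable [measurable (raw)]:
  assumes "k \<in> {1..m}" "F \<in> measurable N M" "G \<in> borel_measurable N"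
  shows "(\<lambda>x. g n k (F x) (G x)) \<in> borel_measurable N"
proof -
  have "(\<lambda>x. \<Sum>i=1..n. ln (cmod (G x - X i k (F x)))) \<in> borel_measurable N"
  proof (rule borel_measurable_sum)
    fix i assume "i \<in> {1..n}"
    then have [measurable]: "(\<lambda>x. X i k (F x)) \<in> borel_measurable N"
      using assms(1) by (intro measurable_compose[OF assms(2) X_measurable]) auto
    note [measurable] = assms(3)
    show "(\<lambda>x. ln (cmod (G x - X i k (F x)))) \<in> borel_measurable N" by measurable
  qed
  then show ?thesis unfolding g_def by measurable
qed

lemma bad_measurable [measurable (raw)]:
  assumes "F \<in> measurable N M" "G \<in> borel_measurable N"
  shows "Measurable.pred N (\<lambda>x. bad n (F x) (G x))"
proof -
  have [measurable]: "(\<lambda>x. q n k (F x) (G x)) \<in> borel_measurable N" if "k \<in> {1..m}" for k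
    using that assms by (rule q_measurable)
  show ?thesis unfolding bad_def
    by (intro pred_intros_finite pred_intros_logic) auto
qed

lemma measurable_U' [measurable (raw)]:
  assumes "k \<in> {1..m}" "G \<in> borel_measurable N"
  shows "(\<lambda>x. U k (G x)) \<in> borel_measurable N"
  by (rule measurable_compose[OF assms(2) measurable_U[OF assms(1)]])

text \<open>After Tonelli the expectation is taken at fixed z, where \<open>g\<close> is a mean of
  independent copies of \<open>ln |z - X|\<close> with expectation \<open>U k z\<close>. The
  resulting factor \<open>1 / n\<close> multiplies a second moment that is finite after averaging
  over z.\<close>

lemma nn_integral_g_U:
  assumes n: "n \<ge> 1" and k: "k \<in> {1..m}"
  shows "(\<integral>\<^sup>+\<omega>. \<integral>\<^sup>+z. ennreal ((g n k \<omega> z - U k z)\<^sup>2) \<partial>\<nu> \<partial>M) \<le> ennreal (c + (ln (2 * R))\<^sup>2) * ennreal (1 / n)"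
proof -
  interpret \<mu>: prob_space "\<mu> k" using k by (rule prob_space_\<mu>)
  interpret \<nu>: prob_space \<nu> by (rule prob_space_\<nu>)
  interpret pair_sigma_finite \<nu> M ..
  note [measurable (raw)] = g_measurable[OF k] measurable_U'[OF k]
  have [measurable_cong]: "sets (\<mu> k) = sets borel" using k by (rule sets_\<mu>)
  have "(\<integral>\<^sup>+\<omega>. \<integral>\<^sup>+z. ennreal ((g n k \<omega> z - U k z)\<^sup>2) \<partial>\<nu> \<partial>M) = (\<integral>\<^sup>+z. \<integral>\<^sup>+\<omega>. ennreal ((g n k \<omega> z - U k z)\<^sup>2) \<partial>M \<partial>\<nu>)"
    by (rule Fubini') measurable
  also have "\<dots> \<le> (\<integral>\<^sup>+z. (\<integral>\<^sup>+w. ennreal ((ln (cmod (z - w)))\<^sup>2) \<partial>\<mu> k) * ennreal (1 / n) \<partial>\<nu>)"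
  proof (rule nn_integral_mono)
    fix z
    let ?D = "distr (\<mu> k) borel (\<lambda>w. ln (cmod (z - w)))"
    have "indep_vars (\<lambda>_. borel) (\<lambda>(i, k). X i k) ({1..n} \<times> {k})"
      using k by (intro indep_vars_subset[OF indep]) auto
    also have "{1..n} \<times> {k} = (\<lambda>i. (i, k)) ` {1..n}" by auto
    finally have "indep_vars (\<lambda>_. borel) (\<lambda>i. X i k) {1..n}"
      by (auto dest: indep_vars_reindex[rotated] simp: inj_on_def)
    then have ind: "indep_vars (\<lambda>_. borel) (\<lambda>i \<omega>. ln (cmod (z - X i k \<omega>))) {1..n}"
      by (rule indep_vars_compose2) auto
    have "(\<integral>\<^sup>+\<omega>. ennreal (((\<Sum>i\<in>{1..n}. ln (cmod (z - X i k \<omega>))) / card {1..n} - (LINT x|?D. x))\<^sup>2) \<partial>M)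
       \<le> (\<integral>\<^sup>+x. ennreal (x\<^sup>2) \<partial>?D) * ennreal (1 / card {1..n})"
    proof (rule mean_square_deviation_le[OF _ _ ind])
      show "distr M borel (\<lambda>\<omega>. ln (cmod (z - X i k \<omega>))) = ?D" if "i \<in> {1..n}" for i
        using that k by (subst distr_X[symmetric, of i]) (auto simp: distr_distr o_def)
    qed (use n in auto)
    then show "(\<integral>\<^sup>+\<omega>. ennreal ((g n k \<omega> z - U k z)\<^sup>2) \<partial>M) \<le> (\<integral>\<^sup>+w. ennreal ((ln (cmod (z - w)))\<^sup>2) \<partial>\<mu> k) * ennreal (1 / n)"
      by (simp add: g_def U_def integral_distr nn_integral_distr)
  qed
  also have "\<dots> = (\<integral>\<^sup>+z. \<integral>\<^sup>+w. ennreal ((ln (cmod (z - w)))\<^sup>2) \<partial>\<mu> k \<partial>\<nu>) * ennreal (1 / n)"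
    by (rule nn_integral_multc) measurable
  also have "\<dots> \<le> ennreal (c + (ln (2 * R))\<^sup>2) * ennreal (1 / n)"
    by (intro mult_right_mono nn_integral_\<nu>_\<mu>_ln_square k) simp
  finally show ?thesis .
qed

text \<open>The joint law of \<open>Z\<close> and the array is a product, so evaluating at the
  random point \<open>Z\<close> amounts to integrating over z. This is how the probability
  hypothesis enters the estimates.\<close>

lemma emeasure_bad:
  "(\<integral>\<^sup>+\<omega>. \<integral>\<^sup>+z. indicator {p. bad n (fst p) (snd p)} (\<omega>, z) \<partial>\<nu> \<partial>M) = emeasure M {\<omega> \<in> space M. bad n \<omega> (Z \<omega>)}"
proof -
  note [simp del] = One_nat_def
  interpret \<nu>: prob_space \<nu> by (rule prob_space_\<nu>)
  interpret pair_sigma_finite \<nu> M ..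
  let ?I = "{1..} \<times> {1..m}"
  let ?P = "Pi\<^sub>M ?I (\<lambda>_. borel :: complex measure)"
  define Xf where "Xf \<omega> = (\<lambda>(i, k)\<in>?I. X i k \<omega>)" for \<omega>
  have Xf[measurable]: "Xf \<in> measurable M ?P"
    unfolding Xf_def[abs_def] by (rule measurable_restrict) auto
  \<comment> \<open>The event is rewritten as a function of z and of the array alone, since the
    product structure holds for laws on the value spaces and not on \<open>M\<close>.\<close>
  define Q where "Q k x z = (\<Prod>i=1..n. z - x (i, k))" for k :: nat and x :: "nat \<times> nat \<Rightarrow> complex" and z
  define B where "B x z \<longleftrightarrow> (\<exists>k\<in>{1..m}. \<exists>l\<in>{1..m} - {k}.
     1 / 2 \<le> cmod (Q k x z / Q l x z) \<and> cmod (Q k x z / Q l x z) \<le> 2)" for x z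
  have Q[measurable]: "(\<lambda>p. Q k (snd p) (fst p)) \<in> borel_measurable (borel \<Otimes>\<^sub>M ?P)" if "k \<in> {1..m}" for k
  proof -
    have "(\<lambda>p. snd p (i, k)) \<in> borel_measurable (borel \<Otimes>\<^sub>M ?P)" if "i \<in> {1..n}" for i
      by (rule measurable_compose[OF measurable_snd measurable_component_singleton]) (use that \<open>k \<in> {1..m}\<close> in auto)
    then show ?thesis unfolding Q_def by (intro borel_measurable_prod borel_measurable_diff) auto
  qed
  have Bm[measurable]: "Measurable.pred (borel \<Otimes>\<^sub>M ?P) (\<lambda>p. B (snd p) (fst p))"
    unfolding B_def by (intro pred_intros_finite pred_intros_logic) measurable
  have QX: "Q k (Xf \<omega>) z = q n k \<omega> z" if "k \<in> {1..m}" for k \<omega> z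
    unfolding Q_def q_def using that by (intro prod.cong) (auto simp: Xf_def)
  have BX: "B (Xf \<omega>) z = bad n \<omega> z" for \<omega> z
    unfolding B_def bad_def by (intro bex_cong refl) (simp add: QX)
  have eq: "\<nu> \<Otimes>\<^sub>M distr M ?P Xf = distr M (borel \<Otimes>\<^sub>M ?P) (\<lambda>\<omega>. (Z \<omega>, Xf \<omega>))"
    unfolding \<nu>_def distr_Z[symmetric]
    by (rule distr_pair_indep_set[OF Z Xf indep_Z[folded Xf_def[abs_def]]])
  interpret PX: prob_space "distr M ?P Xf" by (rule prob_space_distr[OF Xf])
  have "emeasure M {\<omega> \<in> space M. bad n \<omega> (Z \<omega>)} =
      emeasure (distr M (borel \<Otimes>\<^sub>M ?P) (\<lambda>\<omega>. (Z \<omega>, Xf \<omega>))) {p \<in> space (borel \<Otimes>\<^sub>M ?P). B (snd p) (fst p)}"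
  proof -
    have ZX: "(\<lambda>\<omega>. (Z \<omega>, Xf \<omega>)) \<in> measurable M (borel \<Otimes>\<^sub>M ?P)" by measurable
    have BS: "{p \<in> space (borel \<Otimes>\<^sub>M ?P). B (snd p) (fst p)} \<in> sets (borel \<Otimes>\<^sub>M ?P)" by measurable
    show ?thesis unfolding emeasure_distr[OF ZX BS]
      by (rule arg_cong[where f="emeasure M"]) (use measurable_space[OF ZX] in \<open>auto simp: BX\<close>)
  qed
  also have "\<dots> = (\<integral>\<^sup>+z. emeasure (distr M ?P Xf) (Pair z -` {p \<in> space (borel \<Otimes>\<^sub>M ?P). B (snd p) (fst p)}) \<partial>\<nu>)"
    unfolding eq[symmetric]
    by (rule PX.emeasure_pair_measure_alt) (simp cong: sets_pair_measure_cong)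
  also have "\<dots> = (\<integral>\<^sup>+z. emeasure M {\<omega> \<in> space M. bad n \<omega> z} \<partial>\<nu>)"
  proof (rule nn_integral_cong)
    fix z
    have "Pair z -` {p \<in> space (borel \<Otimes>\<^sub>M ?P). B (snd p) (fst p)} = {x \<in> space ?P. B x z}"
      by (auto simp: space_pair_measure)
    moreover have "Xf -` {x \<in> space ?P. B x z} \<inter> space M = {\<omega> \<in> space M. bad n \<omega> z}"
      using measurable_space[OF Xf] by (auto simp: BX)
    moreover have "{x \<in> space ?P. B x z} \<in> sets ?P"
      using measurable_compose[OF measurable_Pair1' Bm, of z] by simp
    ultimately show "emeasure (distr M ?P Xf) (Pair z -` {p \<in> space (borel \<Otimes>\<^sub>M ?P). B (snd p) (fst p)})
       = emeasure M {\<omega> \<in> space M. bad n \<omega> z}"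
      by (simp add: emeasure_distr)
  qed
  also have "\<dots> = (\<integral>\<^sup>+z. \<integral>\<^sup>+\<omega>. indicator {p. bad n (fst p) (snd p)} (\<omega>, z) \<partial>M \<partial>\<nu>)"
  proof (rule nn_integral_cong)
    fix z
    have "(\<integral>\<^sup>+\<omega>. indicator {p. bad n (fst p) (snd p)} (\<omega>, z) \<partial>M) = (\<integral>\<^sup>+\<omega>. indicator {\<omega> \<in> space M. bad n \<omega> z} \<omega> \<partial>M)"
      by (intro nn_integral_cong) (auto simp: indicator_def)
    then show "emeasure M {\<omega> \<in> space M. bad n \<omega> z} = (\<integral>\<^sup>+\<omega>. indicator {p. bad n (fst p) (snd p)} (\<omega>, z) \<partial>M)"
      by simp
  qed
  also have "\<dots> = (\<integral>\<^sup>+\<omega>. \<integral>\<^sup>+z. indicator {p. bad n (fst p) (snd p)} (\<omega>, z) \<partial>\<nu> \<partial>M)"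
    by (rule Fubini'[symmetric]) measurable
  finally show ?thesis by simp
qed

text \<open>The comparison passes through the maximum of the \<open>g n k\<close>. The weight
  \<delta> handles its distance to \<open>f\<close> on the exceptional set, the weight
  \<open>s\<close> its distance to \<open>V\<close>. Every term on the right has an integral that
  can be bounded separately.\<close>

lemma f_V_pointwise:
  assumes n: "n \<ge> 1" and \<delta>: "\<delta> > 0" and s: "s > 0" and nz: "\<And>k. k \<in> {1..m} \<Longrightarrow> q n k \<omega> z \<noteq> 0"
  shows "\<bar>f n \<omega> z - V z\<bar> \<le> 2 * real m * ln 2 / real n + 1 / \<delta> * indicator {p. bad n (fst p) (snd p)} (\<omega>, z)
     + \<delta> * (f n \<omega> z)\<^sup>2 + (\<Sum>k=1..m. \<delta> * (g n k \<omega> z)\<^sup>2 + (s * (g n k \<omega> z - U k z)\<^sup>2 + 1 / s))"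
proof -
  have ne: "finite {1..m}" "{1..m} \<noteq> {}" using m by auto
  define G where "G = (MAX k\<in>{1..m}. g n k \<omega> z)"
  have gq: "g n k \<omega> z = ln (cmod (q n k \<omega> z)) / n" if "k \<in> {1..m}" for k
  proof -
    have "cmod (z - X i k \<omega>) \<noteq> 0" if "i \<in> {1..n}" for i
      using nz[OF \<open>k \<in> {1..m}\<close>] that by (auto simp: q_def prod_zero_iff)
    then have "ln (\<Prod>i=1..n. cmod (z - X i k \<omega>)) = (\<Sum>i=1..n. ln (cmod (z - X i k \<omega>)))"
      by (intro ln_prod) auto
    then show ?thesis by (simp add: g_def q_def prod_norm)
  qed
  have GV: "\<bar>G - V z\<bar> \<le> (\<Sum>k=1..m. s * (g n k \<omega> z - U k z)\<^sup>2 + 1 / s)"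
  proof -
    have "\<bar>G - V z\<bar> \<le> (\<Sum>k=1..m. \<bar>g n k \<omega> z - U k z\<bar>)"
      unfolding G_def V_def by (rule abs_Max_diff_le[OF ne])
    also have "\<dots> \<le> (\<Sum>k=1..m. s * (g n k \<omega> z - U k z)\<^sup>2 + 1 / s)"
    proof (rule sum_mono)
      show "\<bar>g n k \<omega> z - U k z\<bar> \<le> s * (g n k \<omega> z - U k z)\<^sup>2 + 1 / s" for k
        by (rule abs_le_quadratic'[OF s])
    qed
    finally show ?thesis .
  qed
  have G2: "\<delta> * G\<^sup>2 \<le> (\<Sum>k=1..m. \<delta> * (g n k \<omega> z)\<^sup>2)"
    unfolding G_def sum_distrib_left[symmetric]
    using \<delta> by (intro mult_left_mono Max_power2_le_sum[OF ne]) auto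
  have fG: "\<bar>f n \<omega> z - G\<bar> \<le> 2 * real m * ln 2 / real n + 1 / \<delta> * indicator {p. bad n (fst p) (snd p)} (\<omega>, z)
      + \<delta> * (f n \<omega> z)\<^sup>2 + \<delta> * G\<^sup>2"
  proof (cases "bad n \<omega> z")
    case True
    \<comment> \<open>No lower bound for the sum is available here, so both terms are estimated
      crudely; each contributes half of \<open>1 / \<delta>\<close>.\<close>
    have "\<bar>f n \<omega> z - G\<bar> \<le> 1 / \<delta> + \<delta> * (f n \<omega> z)\<^sup>2 + \<delta> * G\<^sup>2"
    proof -
      have "\<bar>f n \<omega> z - G\<bar> \<le> \<bar>f n \<omega> z\<bar> + \<bar>G\<bar>" by (rule abs_triangle_ineq4)
      moreover have "0 \<le> \<delta> * (f n \<omega> z)\<^sup>2" "0 \<le> \<delta> * G\<^sup>2" using \<delta> by auto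
      ultimately show ?thesis
        using abs_le_quadratic[OF \<delta>, of "f n \<omega> z"] abs_le_quadratic[OF \<delta>, of G] by linarith
    qed
    moreover have "0 \<le> 2 * real m * ln 2 / real n" by simp
    moreover have "indicator {p. bad n (fst p) (snd p)} (\<omega>, z) = (1::real)" using True by simp
    ultimately show ?thesis by (simp only: mult_1_right)
  next
    case False
    have GM: "G = (MAX k\<in>{1..m}. ln (cmod (q n k \<omega> z))) / n"
    proof -
      have "(\<lambda>k. g n k \<omega> z) ` {1..m} = (\<lambda>x. x / n) ` (\<lambda>k. ln (cmod (q n k \<omega> z))) ` {1..m}"
        unfolding image_image using gq by (intro image_cong) auto
      then show ?thesis unfolding G_def using m
        by (subst mono_Max_commute[where f="\<lambda>x. x / n"]) (auto simp: mono_def divide_right_mono)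
    qed
    have "\<bar>ln (cmod (\<Sum>k=1..m. q n k \<omega> z)) - (MAX k\<in>{1..m}. ln (cmod (q n k \<omega> z)))\<bar> \<le> m * ln 2"
      using m nz False by (intro ln_sum_separated) (auto simp: bad_def)
    moreover have "0 \<le> ln (real m)" using m by simp
    \<comment> \<open>Absorbs the normalisation \<open>ln m\<close> into a second copy of
      \<open>m * ln 2\<close>.\<close>
    moreover have "ln (real m) \<le> m * ln 2"
    proof -
      have "real m \<le> 2 ^ m" by (rule less_imp_le[OF of_nat_less_two_power])
      then have "ln (real m) \<le> ln (2 ^ m)" using m by (intro ln_mono) auto
      then show ?thesis by (simp add: ln_realpow)
    qed
    ultimately have "\<bar>ln (cmod (\<Sum>k=1..m. q n k \<omega> z)) - ln m - (MAX k\<in>{1..m}. ln (cmod (q n k \<omega> z)))\<bar> \<le> 2 * m * ln 2"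
      by linarith
    then have "\<bar>f n \<omega> z - G\<bar> \<le> 2 * real m * ln 2 / real n"
      unfolding f_def GM diff_divide_distrib[symmetric] abs_divide using n by (simp add: divide_right_mono)
    moreover have "0 \<le> \<delta> * (f n \<omega> z)\<^sup>2" "0 \<le> \<delta> * G\<^sup>2" using \<delta> by auto
    ultimately show ?thesis using False by simp
  qed
  show ?thesis using fG GV G2 by (simp add: sum.distrib)
qed

lemma AE_q_nonzero: "AE z in \<nu>. \<forall>k\<in>{1..m}. q n k \<omega> z \<noteq> 0"
proof -
  have "AE z in \<nu>. z \<notin> (\<lambda>(i, k). X i k \<omega>) ` ({1..n} \<times> {1..m})"
    by (intro AE_\<nu>I AE_not_in finite_imp_null_set_lborel) auto
  then show ?thesis by eventually_elim (force simp: q_def prod_zero_iff)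
qed

text \<open>The second moment bound at radius \<open>R\<close>, serving both the means
  \<open>g\<close> and the variance of a single logarithm; it does not depend on
  \<open>n\<close>.\<close>

definition A :: real where "A = c + (ln (2 * R))\<^sup>2"

lemma A_nonneg: "A \<ge> 0" using c_nonneg by (simp add: A_def)

lemma nn_integral_f_V:
  assumes n: "n \<ge> 1" and \<delta>: "\<delta> > 0" and s: "s > 0" 
    and bad: "measure M {\<omega> \<in> space M. bad n \<omega> (Z \<omega>)} \<le> b"
  shows "(\<integral>\<^sup>+\<omega>. \<integral>\<^sup>+z. ennreal \<bar>f n \<omega> z - V z\<bar> \<partial>\<nu> \<partial>M) \<le>
    ennreal (2 * real m * ln 2 / real n + 1 / \<delta> * b + \<delta> * (c + (ln (4 * real n * R))\<^sup>2) + m * (\<delta> * A + (s * (A * (1 / n)) + 1 / s)))"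
proof -
  interpret \<nu>: prob_space \<nu> by (rule prob_space_\<nu>)
  let ?B = "\<lambda>\<omega>. \<integral>\<^sup>+z. indicator {p. bad n (fst p) (snd p)} (\<omega>, z) \<partial>\<nu>"
  let ?D = "\<lambda>k \<omega>. \<integral>\<^sup>+z. ennreal ((g n k \<omega> z - U k z)\<^sup>2) \<partial>\<nu>"
  let ?c0 = "2 * real m * ln 2 / real n"
  let ?F = "c + (ln (4 * real n * R))\<^sup>2"
  have b: "b \<ge> 0" using bad measure_nonneg order_trans by blast
  \<comment> \<open>The integral over z comes first: the second moments of \<open>f\<close> and
    \<open>g\<close> are bounded for almost every sample point, whereas \<open>?B\<close> and
    \<open>?D\<close> are small only in expectation and are kept for the second integration.\<close>
  have inner: "AE \<omega> in M. (\<integral>\<^sup>+z. ennreal \<bar>f n \<omega> z - V z\<bar> \<partial>\<nu>) \<le>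
    ennreal ?c0 + ennreal (1 / \<delta>) * ?B \<omega> + ennreal \<delta> * ennreal ?F
     + (\<Sum>k=1..m. ennreal \<delta> * ennreal A + (ennreal s * ?D k \<omega> + ennreal (1 / s)))"
    using AE_X_bounded[of n] AE_space
  proof eventually_elim
    case (elim \<omega>)
    note \<omega> = elim(2)
    have [measurable]: "(\<lambda>z. f n \<omega> z) \<in> borel_measurable \<nu>" "Measurable.pred \<nu> (\<lambda>z. bad n \<omega> z)"
      using \<omega> by (auto intro!: f_measurable bad_measurable)
    have [measurable]: "(\<lambda>z. indicator {p. bad n (fst p) (snd p)} (\<omega>, z) :: ennreal) \<in> borel_measurable \<nu>"
      unfolding indicator_def by simp
    have gm[measurable]: "(\<lambda>z. g n k \<omega> z) \<in> borel_measurable \<nu>" "U k \<in> borel_measurable \<nu>" if "k \<in> {1..m}" for k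
      using \<omega> that measurable_U[of k] by (auto intro!: g_measurable)
    have "(\<integral>\<^sup>+z. ennreal \<bar>f n \<omega> z - V z\<bar> \<partial>\<nu>) \<le>
       (\<integral>\<^sup>+z. ennreal ?c0 + ennreal (1 / \<delta>) * indicator {p. bad n (fst p) (snd p)} (\<omega>, z) + ennreal \<delta> * ennreal ((f n \<omega> z)\<^sup>2)
         + (\<Sum>k=1..m. ennreal \<delta> * ennreal ((g n k \<omega> z)\<^sup>2) + (ennreal s * ennreal ((g n k \<omega> z - U k z)\<^sup>2) + ennreal (1 / s))) \<partial>\<nu>)"
    proof (rule nn_integral_mono_AE)
      show "AE z in \<nu>. ennreal \<bar>f n \<omega> z - V z\<bar> \<le>
        ennreal ?c0 + ennreal (1 / \<delta>) * indicator {p. bad n (fst p) (snd p)} (\<omega>, z) + ennreal \<delta> * ennreal ((f n \<omega> z)\<^sup>2)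
         + (\<Sum>k=1..m. ennreal \<delta> * ennreal ((g n k \<omega> z)\<^sup>2) + (ennreal s * ennreal ((g n k \<omega> z - U k z)\<^sup>2) + ennreal (1 / s)))"
        using AE_q_nonzero[of n \<omega>]
      proof eventually_elim
        case (elim z)
        have "ennreal \<bar>f n \<omega> z - V z\<bar> \<le> ennreal (?c0 + 1 / \<delta> * indicator {p. bad n (fst p) (snd p)} (\<omega>, z)
          + \<delta> * (f n \<omega> z)\<^sup>2 + (\<Sum>k=1..m. \<delta> * (g n k \<omega> z)\<^sup>2 + (s * (g n k \<omega> z - U k z)\<^sup>2 + 1 / s)))"
          using elim by (intro ennreal_leI f_V_pointwise[OF n \<delta> s]) auto
        also have "\<dots> = ennreal ?c0 + ennreal (1 / \<delta>) * ennreal (indicator {p. bad n (fst p) (snd p)} (\<omega>, z)) + ennreal \<delta> * ennreal ((f n \<omega> z)\<^sup>2)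
         + (\<Sum>k=1..m. ennreal \<delta> * ennreal ((g n k \<omega> z)\<^sup>2) + (ennreal s * ennreal ((g n k \<omega> z - U k z)\<^sup>2) + ennreal (1 / s)))"
        proof -
          have "(\<Sum>k=1..m. ennreal \<delta> * ennreal ((g n k \<omega> z)\<^sup>2) + (ennreal s * ennreal ((g n k \<omega> z - U k z)\<^sup>2) + ennreal (1 / s)))
            = (\<Sum>k=1..m. ennreal (\<delta> * (g n k \<omega> z)\<^sup>2 + (s * (g n k \<omega> z - U k z)\<^sup>2 + 1 / s)))"
            using \<delta> s by (simp add: ennreal_mult[symmetric] ennreal_plus[symmetric] del: ennreal_plus sum_ennreal)
          also have "\<dots> = ennreal (\<Sum>k=1..m. \<delta> * (g n k \<omega> z)\<^sup>2 + (s * (g n k \<omega> z - U k z)\<^sup>2 + 1 / s))"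
            using \<delta> s by (intro sum_ennreal) simp
          moreover have "0 \<le> (\<Sum>k=1..m. \<delta> * (g n k \<omega> z)\<^sup>2 + (s * (g n k \<omega> z - U k z)\<^sup>2 + 1 / s))"
            using \<delta> s by (intro sum_nonneg) simp
          ultimately show ?thesis
            using \<delta> by (simp add: ennreal_mult[symmetric] ennreal_plus[symmetric] del: ennreal_plus)
        qed
        finally show ?case by (simp only: ennreal_indicator)
      qed
    qed
    also have "\<dots> = ennreal ?c0 + ennreal (1 / \<delta>) * ?B \<omega> + ennreal \<delta> * (\<integral>\<^sup>+z. ennreal ((f n \<omega> z)\<^sup>2) \<partial>\<nu>)
       + (\<Sum>k=1..m. ennreal \<delta> * (\<integral>\<^sup>+z. ennreal ((g n k \<omega> z)\<^sup>2) \<partial>\<nu>) + (ennreal s * ?D k \<omega> + ennreal (1 / s)))"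
      by (rule \<nu>.nn_integral_affine_sum) measurable
    also have "\<dots> \<le> ennreal ?c0 + ennreal (1 / \<delta>) * ?B \<omega> + ennreal \<delta> * ennreal ?F
       + (\<Sum>k=1..m. ennreal \<delta> * ennreal A + (ennreal s * ?D k \<omega> + ennreal (1 / s)))"
    proof -
      have "(\<integral>\<^sup>+z. ennreal ((f n \<omega> z)\<^sup>2) \<partial>\<nu>) \<le> ennreal ?F"
        using nn_integral_f_square[OF n elim(1)] by simp
      moreover have "(\<integral>\<^sup>+z. ennreal ((g n k \<omega> z)\<^sup>2) \<partial>\<nu>) \<le> ennreal A" if "k \<in> {1..m}" for k
        unfolding A_def by (rule nn_integral_g_square[OF n that elim(1)])
      ultimately show ?thesis by (intro add_mono mult_left_mono sum_mono order_refl) auto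
    qed
    finally show ?case .
  qed
  have Bm[measurable]: "?B \<in> borel_measurable M"
  proof -
    have [measurable]: "Measurable.pred (M \<Otimes>\<^sub>M \<nu>) (\<lambda>p. bad n (fst p) (snd p))"
      by (intro bad_measurable) auto
    show ?thesis by (rule \<nu>.borel_measurable_nn_integral) (simp add: indicator_def case_prod_beta)
  qed
  have Dm[measurable]: "?D k \<in> borel_measurable M" if "k \<in> {1..m}" for k
  proof -
    have [measurable]: "(\<lambda>p. g n k (fst p) (snd p)) \<in> borel_measurable (M \<Otimes>\<^sub>M \<nu>)" "(\<lambda>p. U k (snd p)) \<in> borel_measurable (M \<Otimes>\<^sub>M \<nu>)"
      using that by (auto intro!: g_measurable measurable_U')
    show ?thesis by (rule \<nu>.borel_measurable_nn_integral) (simp add: case_prod_beta)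
  qed
  have "(\<integral>\<^sup>+\<omega>. \<integral>\<^sup>+z. ennreal \<bar>f n \<omega> z - V z\<bar> \<partial>\<nu> \<partial>M) \<le>
     (\<integral>\<^sup>+\<omega>. ennreal ?c0 + ennreal (1 / \<delta>) * ?B \<omega> + ennreal \<delta> * ennreal ?F
     + (\<Sum>k=1..m. ennreal \<delta> * ennreal A + (ennreal s * ?D k \<omega> + ennreal (1 / s))) \<partial>M)"
    by (rule nn_integral_mono_AE[OF inner])
  also have "\<dots> = ennreal ?c0 + ennreal (1 / \<delta>) * (\<integral>\<^sup>+\<omega>. ?B \<omega> \<partial>M) + ennreal \<delta> * ennreal ?F
     + (\<Sum>k=1..m. ennreal \<delta> * ennreal A + (ennreal s * (\<integral>\<^sup>+\<omega>. ?D k \<omega> \<partial>M) + ennreal (1 / s)))"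
    by (subst nn_integral_affine_sum) (auto simp: emeasure_space_1)
  also have "\<dots> \<le> ennreal ?c0 + ennreal (1 / \<delta>) * ennreal b + ennreal \<delta> * ennreal ?F
     + (\<Sum>k=1..m. ennreal \<delta> * ennreal A + (ennreal s * (ennreal A * ennreal (1 / n)) + ennreal (1 / s)))"
    unfolding emeasure_bad unfolding emeasure_eq_measure A_def using n bad
    by (intro add_mono mult_left_mono sum_mono nn_integral_g_U order_refl ennreal_leI) auto
  also have "\<dots> = ennreal (?c0 + 1 / \<delta> * b + \<delta> * ?F + m * (\<delta> * A + (s * (A * (1 / n)) + 1 / s)))"
    using \<delta> s A_nonneg b c_nonneg
    by (simp add: ennreal_mult[symmetric] ennreal_plus[symmetric] ennreal_of_nat_eq_real_of_nat del: ennreal_plus)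
  finally show ?thesis .
qed

section \<open>From zeros to integrals, and convergence in probability\<close>

lemma measurable_laplacian [measurable]: "laplacian \<phi> \<in> borel_measurable borel"
  by (intro borel_measurable_continuous_onI continuous_on_laplacian \<phi>)

lemma f_borel_measurable: "\<omega> \<in> space M \<Longrightarrow> f n \<omega> \<in> borel_measurable borel"
  using f_measurable[of "\<lambda>_. \<omega>" borel "\<lambda>z. z" n] by simp

text \<open>The fundamental solution is applied at each zero and averaged. The identity includes
  \<open>n = 0\<close>, where division by zero makes both sides 0, since
  \<open>converges_in_prob\<close> asks for measurability at every index.\<close>

lemma mean_roots:
  assumes \<omega>: "\<omega> \<in> space M"
  shows "integrable lborel (\<lambda>z. laplacian \<phi> z * of_real (f n \<omega> z))" (is ?int)
    and "1 / of_nat n * (\<Sum>z\<in>#proots (\<Sum>k=1..m. rand_poly X n k \<omega>). \<phi> z) =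
      1 / (2 * of_real pi) * (LINT z|lborel. laplacian \<phi> z * of_real (f n \<omega> z))" (is ?eq)
proof -
  note [measurable] = f_borel_measurable[OF \<omega>, of n]
  obtain r where "\<And>i. i < n \<Longrightarrow> poly (\<Sum>k=1..m. rand_poly X n k \<omega>) (r i) = 0"
    and r: "\<And>h :: complex \<Rightarrow> complex. (\<Sum>z\<in>#proots (\<Sum>k=1..m. rand_poly X n k \<omega>). h z) = (\<Sum>i<n. h (r i))"
    "\<And>z. z \<notin> r ` {..<n} \<Longrightarrow> f n \<omega> z = (\<Sum>i<n. ln (cmod (z - r i))) / n"
    by (rule f_roots[of n \<omega>]) (rule that)
  let ?S = "\<lambda>z. (\<Sum>i<n. laplacian \<phi> z * of_real (ln (cmod (z - r i)))) / of_nat n"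
  have i: "integrable lborel (\<lambda>z. laplacian \<phi> z * of_real (ln (cmod (z - r i))))" for i
    by (rule integrable_mult_bounded_ln[OF continuous_on_laplacian[OF \<phi>(1)] \<phi>(2) laplacian_outside[OF \<phi>]])
  have iS: "integrable lborel ?S" using i by (intro integrable_divide Bochner_Integration.integrable_sum)
  have ae: "AE z in lborel. ?S z = laplacian \<phi> z * of_real (f n \<omega> z)"
  proof -
    have "AE z in lborel. z \<notin> r ` {..<n}" by (intro AE_not_in finite_imp_null_set_lborel) auto
    then show ?thesis by eventually_elim (simp add: r(2) sum_distrib_left)
  qed
  show ?int by (rule integrable_cong_AE_imp[OF iS _ ae]) measurable
  have "(LINT z|lborel. laplacian \<phi> z * of_real (f n \<omega> z)) = (LINT z|lborel. ?S z)"
    using ae by (intro integral_cong_AE) (measurable, auto)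
  also have "\<dots> = (\<Sum>i<n. 2 * of_real pi * \<phi> (r i)) / of_nat n"
    using i by (simp add: Bochner_Integration.integral_sum integral_laplacian_ln[OF \<phi>])
  finally show ?eq unfolding r(1) by (simp add: sum_distrib_left[symmetric])
qed

lemma log_potential_measurable:
  assumes k: "k \<in> {1..m}"
  shows "log_potential (\<mu> k) \<in> borel_measurable borel"
proof -
  interpret \<mu>: prob_space "\<mu> k" using k by (rule prob_space_\<mu>)
  have [measurable_cong]: "sets (\<mu> k) = sets borel" using k by (rule sets_\<mu>)
  have [measurable]: "ext_ln \<in> borel_measurable borel" unfolding ext_ln_def by measurable
  show ?thesis unfolding log_potential_def by measurable
qed

text \<open>Off the support the Laplacian vanishes; on it the maximum of the potentials is almost
  everywhere finite, so the value 0 that \<open>real_of_ereal\<close> gives to -\<infinity> does not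
  affect the integral.\<close>

lemma limit_eq:
  "(LINT z|lborel. laplacian \<phi> z * of_real (real_of_ereal (MAX k\<in>{1..m}. log_potential (\<mu> k) z)))
    = (LINT z|lborel. laplacian \<phi> z * of_real (V z))"
proof (rule integral_cong_AE)
  have [measurable]: "(\<lambda>z. MAX k\<in>{1..m}. log_potential (\<mu> k) z) \<in> borel_measurable borel"
    using m by (intro borel_measurable_Max log_potential_measurable) auto
  show "(\<lambda>z. laplacian \<phi> z * of_real (real_of_ereal (MAX k\<in>{1..m}. log_potential (\<mu> k) z))) \<in> borel_measurable lborel"
    by measurable
  show "(\<lambda>z. laplacian \<phi> z * of_real (V z)) \<in> borel_measurable lborel" by measurable
  have "AE z in lborel. z \<in> K \<longrightarrow> real_of_ereal (MAX k\<in>{1..m}. log_potential (\<mu> k) z) = V z"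
    using AE_V emeasure_K unfolding \<nu>_def by (subst (asm) AE_uniform_measure) auto
  then show "AE z in lborel. laplacian \<phi> z * of_real (real_of_ereal (MAX k\<in>{1..m}. log_potential (\<mu> k) z))
      = laplacian \<phi> z * of_real (V z)"
    by eventually_elim (auto simp: laplacian_outside[OF \<phi>])
qed

lemma integrable_laplacian_V: "integrable lborel (\<lambda>z. laplacian \<phi> z * of_real (V z))"
proof -
  obtain B where B: "B > 0" "\<And>z. cmod (laplacian \<phi> z) \<le> B"
    using bounded_continuous_compact_support[OF continuous_on_laplacian[OF \<phi>(1)] \<phi>(2) laplacian_outside[OF \<phi>]] by blast
  have "(\<integral>\<^sup>+z. ennreal (norm (laplacian \<phi> z * of_real (V z))) \<partial>lborel) \<le>
     (\<integral>\<^sup>+z. ennreal B * ((1 + ennreal ((V z)\<^sup>2)) * indicator K z) \<partial>lborel)"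
  proof (rule nn_integral_mono)
    fix z
    show "ennreal (norm (laplacian \<phi> z * of_real (V z))) \<le> ennreal B * ((1 + ennreal ((V z)\<^sup>2)) * indicator K z)"
    proof (cases "z \<in> K")
      case True
      have "norm (laplacian \<phi> z * of_real (V z)) \<le> B * (1 + (V z)\<^sup>2)"
        unfolding norm_mult norm_of_real using B abs_le_quadratic'[of 1 "V z"] by (intro mult_mono) auto
      then have "ennreal (norm (laplacian \<phi> z * of_real (V z))) \<le> ennreal (B * (1 + (V z)\<^sup>2))" by (rule ennreal_leI)
      then show ?thesis using True B by (simp add: ennreal_mult)
    qed (simp add: laplacian_outside[OF \<phi>])
  qed
  also have "\<dots> = ennreal B * (emeasure lborel K * (\<integral>\<^sup>+z. 1 + ennreal ((V z)\<^sup>2) \<partial>\<nu>))"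
    by (subst nn_integral_cmult) (auto simp: nn_integral_lborel_K)
  also have "\<dots> = ennreal B * (emeasure lborel K * (1 + (\<integral>\<^sup>+z. ennreal ((V z)\<^sup>2) \<partial>\<nu>)))"
    using prob_space.emeasure_space_1[OF prob_space_\<nu>] by (subst nn_integral_add) auto
  also have "\<dots> < \<infinity>"
    using emeasure_K nn_integral_V_square by (simp add: ennreal_mult_less_top)
  finally show ?thesis by (intro integrableI_bounded) measurable
qed

text \<open>The distance to the limit is at most a constant times the mean of \<open>|f - V|\<close>
  over z. Its expectation tends to 0, and Markov's inequality gives convergence in
  probability.\<close>

lemma converges:
  assumes C: "C > 0"
    and bad: "\<And>n. real n > C \<Longrightarrow> n \<ge> 2 \<Longrightarrow> measure M {\<omega> \<in> space M. bad n \<omega> (Z \<omega>)} \<le> C / ln (real n) ^ 3"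
  shows "converges_in_prob M
           (\<lambda>n \<omega>. 1 / of_nat n * (\<Sum>z\<in>#proots (\<Sum>k=1..m. rand_poly X n k \<omega>). \<phi> z))
           (1 / (2 * of_real pi) *
              (LINT z|lborel. laplacian \<phi> z * of_real (real_of_ereal (MAX k\<in>{1..m}. log_potential (\<mu> k) z))))"
proof -
  define Y where "Y n \<omega> = 1 / of_nat n * (\<Sum>z\<in>#proots (\<Sum>k=1..m. rand_poly X n k \<omega>). \<phi> z)" for n \<omega>
  define y where "y = 1 / (2 * of_real pi) * (LINT z|lborel. laplacian \<phi> z * of_real (V z))"
  have Y: "Y n \<omega> = 1 / (2 * of_real pi) * (LINT z|lborel. laplacian \<phi> z * of_real (f n \<omega> z))" if "\<omega> \<in> space M" for n \<omega>
    unfolding Y_def by (rule mean_roots(2)[OF that])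
  \<comment> \<open>Measurability is read off from the integral representation, so no measurable
    choice of the zeros has to be made.\<close>
  have Ym[measurable]: "Y n \<in> borel_measurable M" for n
  proof -
    have "(\<lambda>(\<omega>, z). laplacian \<phi> z * of_real (f n \<omega> z)) \<in> borel_measurable (M \<Otimes>\<^sub>M lborel)"
    proof -
      have [measurable]: "(\<lambda>p. f n (fst p) (snd p)) \<in> borel_measurable (M \<Otimes>\<^sub>M lborel)"
        by (rule f_measurable) auto
      show ?thesis unfolding case_prod_beta by measurable
    qed
    then have "(\<lambda>\<omega>. LINT z|lborel. laplacian \<phi> z * of_real (f n \<omega> z)) \<in> borel_measurable M"
      by (rule lborel.borel_measurable_lebesgue_integral)
    then have "(\<lambda>\<omega>. 1 / (2 * of_real pi) * (LINT z|lborel. laplacian \<phi> z * of_real (f n \<omega> z))) \<in> borel_measurable M"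
      by measurable
    then show ?thesis using Y by (simp cong: measurable_cong)
  qed
  obtain B where B: "B > 0" "\<And>z. cmod (laplacian \<phi> z) \<le> B"
    using bounded_continuous_compact_support[OF continuous_on_laplacian[OF \<phi>(1)] \<phi>(2) laplacian_outside[OF \<phi>]] by blast
  \<comment> \<open>The bound on the Laplacian, the area that converts \<nu> back to Lebesgue
    measure, and the factor 1 / (2 pi).\<close>
  define L where "L = B * measure lborel K / (2 * pi)"
  have L: "L \<ge> 0" using B by (simp add: L_def)
  have dist_le: "ennreal (dist (Y n \<omega>) y) \<le> ennreal L * (\<integral>\<^sup>+z. ennreal \<bar>f n \<omega> z - V z\<bar> \<partial>\<nu>)" if \<omega>: "\<omega> \<in> space M" for n \<omega>
  proof -
    note [measurable] = f_borel_measurable[OF \<omega>, of n]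
    have "Y n \<omega> - y = 1 / (2 * of_real pi) * (LINT z|lborel. laplacian \<phi> z * of_real (f n \<omega> z) - laplacian \<phi> z * of_real (V z))"
      unfolding Y[OF \<omega>] y_def using mean_roots(1)[OF \<omega>] integrable_laplacian_V
      by (simp add: right_diff_distrib)
    also have "(LINT z|lborel. laplacian \<phi> z * of_real (f n \<omega> z) - laplacian \<phi> z * of_real (V z)) =
       (LINT z|lborel. laplacian \<phi> z * of_real (f n \<omega> z - V z))"
      by (simp add: right_diff_distrib)
    finally have d: "dist (Y n \<omega>) y = 1 / (2 * pi) * norm (LINT z|lborel. laplacian \<phi> z * of_real (f n \<omega> z - V z))"
      by (simp add: dist_norm norm_mult norm_divide)
    have "integrable lborel (\<lambda>z. laplacian \<phi> z * of_real (f n \<omega> z) - laplacian \<phi> z * of_real (V z))"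
      using mean_roots(1)[OF \<omega>] integrable_laplacian_V by (rule Bochner_Integration.integrable_diff)
    then have "integrable lborel (\<lambda>z. laplacian \<phi> z * of_real (f n \<omega> z - V z))"
      by (simp add: right_diff_distrib)
    then have "ennreal (norm (LINT z|lborel. laplacian \<phi> z * of_real (f n \<omega> z - V z)))
      \<le> (\<integral>\<^sup>+z. ennreal (norm (laplacian \<phi> z * of_real (f n \<omega> z - V z))) \<partial>lborel)"
      by (rule integral_norm_bound_ennreal)
    also have "\<dots> \<le> (\<integral>\<^sup>+z. ennreal B * (ennreal \<bar>f n \<omega> z - V z\<bar> * indicator K z) \<partial>lborel)"
    proof (rule nn_integral_mono)
      fix z
      have "norm (laplacian \<phi> z * of_real (f n \<omega> z - V z)) \<le> B * \<bar>f n \<omega> z - V z\<bar>"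
        unfolding norm_mult norm_of_real using B by (intro mult_right_mono) auto
      then have "ennreal (norm (laplacian \<phi> z * of_real (f n \<omega> z - V z))) \<le> ennreal B * ennreal \<bar>f n \<omega> z - V z\<bar>"
        using B by (simp add: ennreal_mult[symmetric] ennreal_leI)
      then show "ennreal (norm (laplacian \<phi> z * of_real (f n \<omega> z - V z))) \<le> ennreal B * (ennreal \<bar>f n \<omega> z - V z\<bar> * indicator K z)"
        by (cases "z \<in> K") (auto simp: laplacian_outside[OF \<phi>])
    qed
    also have "\<dots> = ennreal B * (emeasure lborel K * (\<integral>\<^sup>+z. ennreal \<bar>f n \<omega> z - V z\<bar> \<partial>\<nu>))"
      by (subst nn_integral_cmult) (auto simp: nn_integral_lborel_K)
    also have "emeasure lborel K = ennreal (measure lborel K)"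
      using emeasure_K by (intro emeasure_eq_ennreal_measure) auto
    finally have "ennreal (1 / (2 * pi)) * ennreal (norm (LINT z|lborel. laplacian \<phi> z * of_real (f n \<omega> z - V z)))
      \<le> ennreal (1 / (2 * pi)) * (ennreal B * (ennreal (measure lborel K) * (\<integral>\<^sup>+z. ennreal \<bar>f n \<omega> z - V z\<bar> \<partial>\<nu>)))"
      by (rule mult_left_mono) simp
    moreover have "ennreal (1 / (2 * pi)) * (ennreal B * ennreal (measure lborel K)) = ennreal L"
      using B by (simp add: L_def ennreal_mult[symmetric] divide_simps)
    ultimately have "ennreal (1 / (2 * pi)) * ennreal (norm (LINT z|lborel. laplacian \<phi> z * of_real (f n \<omega> z - V z)))
        \<le> ennreal L * (\<integral>\<^sup>+z. ennreal \<bar>f n \<omega> z - V z\<bar> \<partial>\<nu>)"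
      by (simp only: mult.assoc[symmetric])
    moreover have "ennreal (dist (Y n \<omega>) y) = ennreal (1 / (2 * pi)) * ennreal (norm (LINT z|lborel. laplacian \<phi> z * of_real (f n \<omega> z - V z)))"
      unfolding d by (rule ennreal_mult) auto
    ultimately show ?thesis by (simp only:)
  qed
  \<comment> \<open>The exponent is midway between -3 and -2: the exceptional set and the second
    moment of \<open>f\<close> then both contribute terms of order ln^(-1/2) n.\<close>
  define \<delta> where "\<delta> n = ln (real n) powr (-5/2)" for n
  \<comment> \<open>The weight \<open>s\<close> is \<open>sqrt n\<close>, which balances
    \<open>s / n\<close> against \<open>1 / s\<close>.\<close>
  define b where "b n = 2 * real m * ln 2 / real n + 1 / \<delta> n * (C / ln (real n) ^ 3) + \<delta> n * (c + (ln (4 * real n * R))\<^sup>2)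
      + m * (\<delta> n * A + (sqrt n * (A * (1 / n)) + 1 / sqrt n))" for n
  have b0: "b \<longlonglongrightarrow> 0"
  proof -
    have R0: "R > 0" using R(1) by simp
    have 1: "(\<lambda>n. 2 * real m * ln 2 / real n) \<longlonglongrightarrow> 0" by real_asymp
    have 2: "(\<lambda>n. 1 / \<delta> n * (C / ln (real n) ^ 3)) \<longlonglongrightarrow> 0" unfolding \<delta>_def by real_asymp
    have 3: "\<delta> \<longlonglongrightarrow> 0" unfolding \<delta>_def[abs_def] by real_asymp
    have 4: "(\<lambda>n. \<delta> n * (ln (4 * real n * R))\<^sup>2) \<longlonglongrightarrow> 0" unfolding \<delta>_def using R0 by real_asymp
    have 5: "(\<lambda>n. sqrt (real n) * (A * (1 / real n))) \<longlonglongrightarrow> 0"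
    proof -
      have "(\<lambda>n. sqrt (real n) * (1 / real n)) \<longlonglongrightarrow> 0" by real_asymp
      from tendsto_mult_right_zero[OF this, of A] show ?thesis by (simp only: mult.left_commute)
    qed
    have 6: "(\<lambda>n. 1 / sqrt (real n)) \<longlonglongrightarrow> 0" by real_asymp
    have "(\<lambda>n. 2 * real m * ln 2 / real n + 1 / \<delta> n * (C / ln (real n) ^ 3) + (\<delta> n * c + \<delta> n * (ln (4 * real n * R))\<^sup>2)
      + m * (\<delta> n * A + (sqrt n * (A * (1 / n)) + 1 / sqrt n))) \<longlonglongrightarrow> 0 + 0 + (0 * c + 0) + m * (0 * A + (0 + 0))"
      by (intro tendsto_add tendsto_mult tendsto_const 1 2 3 4 5 6)
    then show ?thesis by (simp add: b_def[abs_def] distrib_left)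
  qed
  have le: "measure M {\<omega> \<in> space M. dist (Y n \<omega>) y > \<epsilon>} \<le> 1 / \<epsilon> * (L * b n)"
    if n: "real n > C" "n \<ge> 3" and \<epsilon>: "\<epsilon> > 0" for n \<epsilon>
  proof -
    interpret \<nu>: prob_space \<nu> by (rule prob_space_\<nu>)
    have lnn: "ln (real n) > 0" using n by simp
    have \<delta>0: "\<delta> n > 0" using lnn by (simp add: \<delta>_def)
    have b: "b n \<ge> 0" unfolding b_def using \<delta>0 lnn C c_nonneg A_nonneg by (intro add_nonneg_nonneg mult_nonneg_nonneg) auto
    have Im[measurable]: "(\<lambda>\<omega>. \<integral>\<^sup>+z. ennreal \<bar>f n \<omega> z - V z\<bar> \<partial>\<nu>) \<in> borel_measurable M"
    proof -
      have [measurable]: "(\<lambda>p. f n (fst p) (snd p)) \<in> borel_measurable (M \<Otimes>\<^sub>M \<nu>)"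
        by (rule f_measurable) auto
      show ?thesis by (rule \<nu>.borel_measurable_nn_integral) (simp add: case_prod_beta)
    qed
    have "emeasure M {\<omega> \<in> space M. dist (Y n \<omega>) y > \<epsilon>} \<le> emeasure M {\<omega> \<in> space M. 1 \<le> ennreal (1 / \<epsilon>) * ennreal (dist (Y n \<omega>) y)}"
      using \<epsilon> by (intro emeasure_mono) (auto simp: ennreal_mult[symmetric] ennreal_1[symmetric] simp del: ennreal_1 intro!: ennreal_leI)
    also have "\<dots> \<le> ennreal (1 / \<epsilon>) * (\<integral>\<^sup>+\<omega>. ennreal (dist (Y n \<omega>) y) * indicator (space M) \<omega> \<partial>M)"
      by (rule nn_integral_Markov_inequality) measurable
    also have "\<dots> \<le> ennreal (1 / \<epsilon>) * (\<integral>\<^sup>+\<omega>. ennreal L * (\<integral>\<^sup>+z. ennreal \<bar>f n \<omega> z - V z\<bar> \<partial>\<nu>) \<partial>M)"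
      by (intro mult_left_mono nn_integral_mono) (auto simp: dist_le)
    also have "\<dots> = ennreal (1 / \<epsilon>) * (ennreal L * (\<integral>\<^sup>+\<omega>. \<integral>\<^sup>+z. ennreal \<bar>f n \<omega> z - V z\<bar> \<partial>\<nu> \<partial>M))"
      by (subst nn_integral_cmult) auto
    also have "\<dots> \<le> ennreal (1 / \<epsilon>) * (ennreal L * ennreal (b n))"
      unfolding b_def using n \<delta>0
      by (intro mult_left_mono nn_integral_f_V bad) auto
    also have "\<dots> = ennreal (1 / \<epsilon> * (L * b n))" using \<epsilon> L b by (simp add: ennreal_mult[symmetric])
    finally show ?thesis using \<epsilon> L b by (simp add: emeasure_eq_measure)
  qed
  have "(\<lambda>n. measure M {\<omega> \<in> space M. dist (Y n \<omega>) y > \<epsilon>}) \<longlonglongrightarrow> 0" if \<epsilon>: "\<epsilon> > 0" for \<epsilon>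
  proof (rule tendsto_sandwich[OF _ _ tendsto_const])
    show "(\<lambda>n. 1 / \<epsilon> * (L * b n)) \<longlonglongrightarrow> 0"
      using b0 by (intro tendsto_mult_right_zero)
    have "eventually (\<lambda>n. real n > C) sequentially" by real_asymp
    with eventually_ge_at_top[of 3]
    show "\<forall>\<^sub>F n in sequentially. measure M {\<omega> \<in> space M. dist (Y n \<omega>) y > \<epsilon>} \<le> 1 / \<epsilon> * (L * b n)"
      by eventually_elim (use le \<epsilon> in auto)
  qed auto
  then show ?thesis
    unfolding limit_eq converges_in_prob_def y_def[symmetric] Y_def[symmetric] using Ym by blast
qed

end

theorem theorem1p14:
  fixes m :: nat
    and \<mu> :: "nat \<Rightarrow> complex measure"
    and M :: "'a measure"
    and X :: "nat \<Rightarrow> nat \<Rightarrow> 'a \<Rightarrow> complex"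
    and Z :: "'a \<Rightarrow> complex"
    and \<phi> :: "complex \<Rightarrow> complex"
    and C :: real
  assumes "m \<ge> 2"
    and "\<And>k. k \<in> {1..m} \<Longrightarrow> \<mu> k \<in> compact_prob_measures"
    and "prob_space M"
    and "prob_space.indep_vars M (\<lambda>_. borel) (\<lambda>(i, k). X i k) ({1..} \<times> {1..m})"
    and "\<And>i k. i \<ge> 1 \<Longrightarrow> k \<in> {1..m} \<Longrightarrow> distr M borel (X i k) = \<mu> k"
    and "smooth \<phi>"
    and "compact (fsupport \<phi>)"
    and "\<exists>z. \<phi> z \<noteq> 0"
    and "Z \<in> borel_measurable M"
    and "distr M borel Z = uniform_measure lborel (fsupport \<phi>)"
    and "prob_space.indep_set M
           (sets (vimage_algebra (space M) Z borel))
           (sets (vimage_algebra (space M) (\<lambda>\<omega>. \<lambda>(i, k)\<in>{1..} \<times> {1..m}. X i k \<omega>)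
              (Pi\<^sub>M ({1..} \<times> {1..m}) (\<lambda>_. borel))))"
    and "C > 0"
    and "\<And>n::nat. real n > C \<Longrightarrow> n \<ge> 2 \<Longrightarrow>
           measure M (\<Union>k\<in>{1..m}. \<Union>l\<in>{1..m} - {k}.
             {\<omega> \<in> space M.
                1 / 2 \<le> cmod (poly (rand_poly X n k \<omega>) (Z \<omega>) / poly (rand_poly X n l \<omega>) (Z \<omega>)) \<and>
                cmod (poly (rand_poly X n k \<omega>) (Z \<omega>) / poly (rand_poly X n l \<omega>) (Z \<omega>)) \<le> 2})
           \<le> C / ln (real n) ^ 3"
  shows "converges_in_prob M
           (\<lambda>n \<omega>. 1 / of_nat n *
              (\<Sum>z\<in>#proots (\<Sum>k=1..m. rand_poly X n k \<omega>). \<phi> z))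
           (1 / (2 * of_real pi) *
              (LINT z|lborel. laplacian \<phi> z *
                 of_real (real_of_ereal (MAX k\<in>{1..m}. log_potential (\<mu> k) z))))"
proof -
  have "\<forall>k\<in>{1..m}. \<exists>r. AE w in \<mu> k. cmod w \<le> r"
    by (intro ballI, rule compact_prob_measure_bounded[OF assms(2)]) blast+
  from bchoice[OF this] obtain r where r: "\<And>k. k \<in> {1..m} \<Longrightarrow> AE w in \<mu> k. cmod w \<le> r k"
    by blast
  obtain r0 where r0: "\<And>z. z \<in> fsupport \<phi> \<Longrightarrow> cmod z \<le> r0"
    using compact_imp_bounded[OF assms(7)] by (auto simp: bounded_iff)
  \<comment> \<open>The bounds for the finitely many measures and for the support are merged;
    inserting 1 secures \<open>R >= 1\<close>.\<close>
  define R where "R = Max (insert 1 (insert r0 (r ` {1..m})))"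
  have R: "1 \<le> R" "r0 \<le> R" "\<And>k. k \<in> {1..m} \<Longrightarrow> r k \<le> R"
    unfolding R_def by (rule Max_ge, (auto)[2])+
  have Rk: "AE w in \<mu> k. cmod w \<le> R" if "k \<in> {1..m}" for k
    using r[OF that] R(3)[OF that] by (auto elim!: eventually_mono)
  interpret prob_space M by (rule assms)
  interpret random_polynomial_sum M m \<mu> X Z \<phi> R
  proof unfold_locales
    show "m \<ge> 1" using assms(1) by simp
    show "cmod z \<le> R" if "z \<in> fsupport \<phi>" for z using r0[OF that] R(2) by linarith
  qed (fact assms R(1) Rk)+
  show ?thesis
  proof (rule converges[OF assms(12)])
    fix n :: nat assume n: "real n > C" "n \<ge> 2"
    have "{\<omega> \<in> space M. bad n \<omega> (Z \<omega>)} = (\<Union>k\<in>{1..m}. \<Union>l\<in>{1..m} - {k}.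
             {\<omega> \<in> space M.
                1 / 2 \<le> cmod (poly (rand_poly X n k \<omega>) (Z \<omega>) / poly (rand_poly X n l \<omega>) (Z \<omega>)) \<and>
                cmod (poly (rand_poly X n k \<omega>) (Z \<omega>) / poly (rand_poly X n l \<omega>) (Z \<omega>)) \<le> 2})"
      unfolding poly_rand_poly q_def[symmetric] by (auto simp: bad_def)
    then show "measure M {\<omega> \<in> space M. bad n \<omega> (Z \<omega>)} \<le> C / ln (real n) ^ 3"
      using assms(13)[OF n] by simp
  qed
qed

end
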